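(* Let $0<\gamma<1$ be a quadratic irrational such that $1/\gamma$ has a purely periodic continued fraction, and let $\alpha,\beta\in\mathbb{Q}(\gamma)$. Then the first-order theory of the natural numbers $\mathbb{N}$ with addition and the function $n\mapsto\lfloor n\alpha+\beta\rfloor$ is decidable; that is, the set of first-order sentences true in the structure $(\mathbb{N},+,R)$, where $R=\{(n,y)\in\mathbb{N}^2 : y=\lfloor n\alpha+\beta\rfloor\}$, is decidable.
   Context: $\mathbb{N}=\{0,1,2,\ldots\}$. A continued fraction is purely periodic if it has the form $[a_1,\ldots,a_P,a_1,\ldots,a_P,a_1,\ldots,a_P,\ldots]$ for some $P\ge 1$. *)

theory Defs
  imports Complex_Main "HOL-Library.Nat_Bijection"
begin

section \<open>Quadratic irrationals and continued fractions\<close>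

definition quadratic_irrational :: "real \<Rightarrow> bool" where
  "quadratic_irrational x \<longleftrightarrow> x \<notin> \<rat> \<and>
     (\<exists>a b c :: int. a \<noteq> 0 \<and> of_int a * x\<^sup>2 + of_int b * x + of_int c = 0)"

text \<open>The field \<open>\<rat>(x)\<close>: the least subfield of \<open>\<real>\<close> that contains \<open>x\<close>.\<close>

inductive_set rat_adjoin :: "real \<Rightarrow> real set" for x :: real where
  rat: "q \<in> \<rat> \<Longrightarrow> q \<in> rat_adjoin x"
| gen: "x \<in> rat_adjoin x"
| add: "u \<in> rat_adjoin x \<Longrightarrow> v \<in> rat_adjoin x \<Longrightarrow> u + v \<in> rat_adjoin x"
| uminus: "u \<in> rat_adjoin x \<Longrightarrow> - u \<in> rat_adjoin x"
| mult: "u \<in> rat_adjoin x \<Longrightarrow> v \<in> rat_adjoin x \<Longrightarrow> u * v \<in> rat_adjoin x"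
| inverse: "u \<in> rat_adjoin x \<Longrightarrow> u \<noteq> 0 \<Longrightarrow> inverse u \<in> rat_adjoin x"

primrec cf_convergent :: "(nat \<Rightarrow> int) \<Rightarrow> nat \<Rightarrow> real" where
  "cf_convergent a 0 = of_int (a 0)"
| "cf_convergent a (Suc n) = of_int (a 0) + 1 / cf_convergent (\<lambda>i. a (Suc i)) n"

text \<open>Infinite simple continued fractions. The leading term may be any integer; all later
  partial quotients are positive.\<close>

definition is_cf_of :: "(nat \<Rightarrow> int) \<Rightarrow> real \<Rightarrow> bool" where
  "is_cf_of a x \<longleftrightarrow> (\<forall>i\<ge>1. a i \<ge> 1) \<and> cf_convergent a \<longlonglongrightarrow> x"

definition has_purely_periodic_cf :: "real \<Rightarrow> bool" where
  "has_purely_periodic_cf x \<longleftrightarrow>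
     (\<exists>a P. P \<ge> 1 \<and> (\<forall>i. a (i + P) = a i) \<and> is_cf_of a x)"


section \<open>First-order logic over \<open>(\<nat>, +, R)\<close>\<close>

text \<open>The signature has a binary function symbol for addition and one binary relation symbol;
  equality is logical. Variables are named by natural numbers.\<close>

datatype tm = Var nat | Plus tm tm

datatype fm = Eq tm tm | Rel tm tm | Neg fm | Conj fm fm | Ex nat fm

primrec tm_vars :: "tm \<Rightarrow> nat set" where
  "tm_vars (Var i) = {i}"
| "tm_vars (Plus s t) = tm_vars s \<union> tm_vars t"

primrec free_vars :: "fm \<Rightarrow> nat set" where
  "free_vars (Eq s t) = tm_vars s \<union> tm_vars t"
| "free_vars (Rel s t) = tm_vars s \<union> tm_vars t"
| "free_vars (Neg p) = free_vars p"
| "free_vars (Conj p q) = free_vars p \<union> free_vars q"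
| "free_vars (Ex i p) = free_vars p - {i}"

definition sentence :: "fm \<Rightarrow> bool" where
  "sentence p \<longleftrightarrow> free_vars p = {}"

primrec tm_val :: "(nat \<Rightarrow> nat) \<Rightarrow> tm \<Rightarrow> nat" where
  "tm_val e (Var i) = e i"
| "tm_val e (Plus s t) = tm_val e s + tm_val e t"

primrec sat :: "(nat \<times> nat) set \<Rightarrow> (nat \<Rightarrow> nat) \<Rightarrow> fm \<Rightarrow> bool" where
  "sat R e (Eq s t) \<longleftrightarrow> tm_val e s = tm_val e t"
| "sat R e (Rel s t) \<longleftrightarrow> (tm_val e s, tm_val e t) \<in> R"
| "sat R e (Neg p) \<longleftrightarrow> \<not> sat R e p"
| "sat R e (Conj p q) \<longleftrightarrow> sat R e p \<and> sat R e q"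
| "sat R e (Ex i p) \<longleftrightarrow> (\<exists>n. sat R (e(i := n)) p)"

definition true_sentences :: "(nat \<times> nat) set \<Rightarrow> fm set" where
  "true_sentences R = {p. sentence p \<and> (\<forall>e. sat R e p)}"


section \<open>Decidability\<close>

text \<open>Total recursive functions. Only arguments of the given length matter: \<open>recursive n f\<close>
  is about the restriction of \<open>f\<close> to lists of length \<open>n\<close>. Minimization is applied only where
  a zero always exists, so the class consists of exactly the total \<open>\<mu>\<close>-recursive functions.\<close>

inductive recursive :: "nat \<Rightarrow> (nat list \<Rightarrow> nat) \<Rightarrow> bool" where
  zero: "recursive n (\<lambda>xs. 0)"
| succ: "recursive 1 (\<lambda>xs. Suc (xs ! 0))"
| proj: "i < n \<Longrightarrow> recursive n (\<lambda>xs. xs ! i)"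
| comp: "recursive (length gs) f \<Longrightarrow> (\<forall>g\<in>set gs. recursive n g) \<Longrightarrow>
    recursive n (\<lambda>xs. f (map (\<lambda>g. g xs) gs))"
| prec: "recursive n f \<Longrightarrow> recursive (Suc (Suc n)) g \<Longrightarrow>
    recursive (Suc n) (\<lambda>xs. rec_nat (f (tl xs)) (\<lambda>y r. g (y # r # tl xs)) (hd xs))"
| minim: "recursive (Suc n) f \<Longrightarrow> (\<forall>xs. length xs = n \<longrightarrow> (\<exists>y. f (y # xs) = 0)) \<Longrightarrow>
    recursive n (\<lambda>xs. LEAST y. f (y # xs) = 0)"

definition decidable :: "nat set \<Rightarrow> bool" where
  "decidable A \<longleftrightarrow> (\<exists>f. recursive 1 f \<and> (\<forall>n. f [n] = (if n \<in> A then 1 else 0)))"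

text \<open>An explicit coding of formulas by numbers, so that sets of formulas become sets of numbers.\<close>

primrec tm_code :: "tm \<Rightarrow> nat" where
  "tm_code (Var i) = prod_encode (0, i)"
| "tm_code (Plus s t) = prod_encode (1, prod_encode (tm_code s, tm_code t))"

primrec fm_code :: "fm \<Rightarrow> nat" where
  "fm_code (Eq s t) = prod_encode (0, prod_encode (tm_code s, tm_code t))"
| "fm_code (Rel s t) = prod_encode (1, prod_encode (tm_code s, tm_code t))"
| "fm_code (Neg p) = prod_encode (2, fm_code p)"
| "fm_code (Conj p q) = prod_encode (3, prod_encode (fm_code p, fm_code q))"
| "fm_code (Ex i p) = prod_encode (4, prod_encode (i, fm_code p))"

lemma tm_code_eq_iff: "tm_code s = tm_code t \<longleftrightarrow> s = t"
proof (induction s arbitrary: t)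
  case (Var i)
  then show ?case by (cases t) auto
next
  case (Plus s1 s2)
  then show ?case by (cases t) auto
qed

lemma fm_code_eq_iff: "fm_code p = fm_code q \<longleftrightarrow> p = q"
proof (induction p arbitrary: q)
  case (Eq s t)
  then show ?case by (cases q) (auto simp: tm_code_eq_iff)
next
  case (Rel s t)
  then show ?case by (cases q) (auto simp: tm_code_eq_iff)
next
  case (Neg p)
  then show ?case by (cases q) auto
next
  case (Conj p1 p2)
  then show ?case by (cases q) auto
next
  case (Ex i p)
  then show ?case by (cases q) auto
qed

end

theory Submission
  imports Defs
begin

text \<open>Let \<open>\<epsilon> > 1\<close> be the unit of norm \<open>1\<close> that the period of \<open>1 / \<gamma>\<close> provides, and \<open>d = 1 / \<epsilon>\<close> its
  conjugate. Write natural numbers (not uniquely) as \<open>\<Sum> a\<^sub>k u\<^sub>k\<close> with bounded digits, where \<open>u\<close> is the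
  linear recurrence of \<open>\<epsilon>\<close>. The relation \<open>y = \<lfloor>x \<alpha> + \<beta>\<rfloor>\<close> of digit strings read from the most significant
  digit then has a congruence of finite index: a linear combination that controls \<open>y - x \<alpha>\<close> either takes
  one of finitely many values in \<open>\<int>[\<epsilon>]\<close> or has become too large to return, and the rest is the
  position of the conjugate of \<open>x\<close> among finitely many thresholds. Finite index is preserved by
  negation, conjunction and, passing to sets of classes, by quantifiers.

  No automaton needs to be computed. The index of a formula is bounded by a recursive function of its
  code, and by pumping it bounds the smallest witness of a quantifier in terms of the parameters. So a
  sentence is decided by evaluating it with bounded quantifiers.\<close>

section \<open>Computable functions of an environment\<close>

text \<open>A formula reads only the values of the strings. So representations need not be unique or
  normalised: a quantifier may range over all strings, sums are formed digitwise without carries,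
  and it suffices that every natural number has some string. The obstacle is that
  \<open>d * x\<close> is not an integer. If \<open>X\<close> represents \<open>x\<close>, then
  \<open>d * x = snd X + cj X\<close> with \<open>cj X\<close> in a fixed interval, so the
  inequalities behind the floor become an integer form plus \<open>b * cj X\<close>. A true relation
  bounds the integer form. The form's own conjugate is always bounded, which leaves finitely many
  pairs and makes a large form grow with every digit, because \<open>1 / d > 1\<close>. But
  \<open>cj X\<close> takes infinitely many values, so only its comparisons with some
  \<open>m + n * d\<close> can be remembered. A finite box of pairs \<open>(m, n)\<close> is closed
  under appending digits, up to comparisons with a foregone outcome. Norm \<open>1\<close> instead
  of \<open>-1\<close> makes \<open>d\<close> positive and keeps every \<open>cj X\<close>
  nonnegative; squaring the unit of one period achieves it.\<close>

text \<open>No arity is fixed, so the closure rules have no side conditions on variable indices. In rules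
  for binders the bound variables come first and the environment is shifted behind them.\<close>

definition computable :: "((nat \<Rightarrow> nat) \<Rightarrow> nat) \<Rightarrow> bool" where
  "computable f \<longleftrightarrow> (\<exists>n g. recursive n g \<and> (\<forall>e. g (map e [0..<n]) = f e))"

definition computable_pred :: "((nat \<Rightarrow> nat) \<Rightarrow> bool) \<Rightarrow> bool" where
  "computable_pred P \<longleftrightarrow> computable (\<lambda>e. if P e then 1 else 0)"

text \<open>Projections discard the surplus arguments. Functions of different arities can thus be
  brought to a common one before they are combined.\<close>

lemma recursive_lift:
  assumes "recursive n g" "n \<le> m"
  shows "\<exists>h. recursive m h \<and> (\<forall>e. h (map e [0..<m]) = g (map e [0..<n]))"
proof -
  let ?gs = "map (\<lambda>i xs. xs ! i) [0..<n]"
  have "recursive m (\<lambda>xs. g (map (\<lambda>h. h xs) ?gs))"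
    using assms by (intro recursive.comp) (auto intro: recursive.proj)
  moreover have "map (\<lambda>h. h (map e [0..<m])) ?gs = map e [0..<n]" for e
    using assms(2) by auto
  ultimately show ?thesis
    by (intro exI[of _ "\<lambda>xs. g (map (\<lambda>h. h xs) ?gs)"] conjI allI arg_cong[of _ _ g])
qed

lemma computable_cong:
  assumes "computable f" "\<And>e. f e = g e"
  shows "computable g"
  using assms by (metis ext)

lemma computable_large:
  assumes "computable f"
  obtains n where "\<And>m. n \<le> m \<Longrightarrow> \<exists>g. recursive m g \<and> (\<forall>e. g (map e [0..<m]) = f e)"
proof -
  obtain n g where g: "recursive n g" "\<And>e. g (map e [0..<n]) = f e"
    using assms by (auto simp: computable_def)
  show thesis
  proof (rule that)
    fix m assume "n \<le> m"
    then show "\<exists>g. recursive m g \<and> (\<forall>e. g (map e [0..<m]) = f e)"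
      using recursive_lift[OF g(1)] g(2) by metis
  qed
qed

lemma computable_subst:
  assumes f: "computable f" and s: "\<And>i. computable (s i)"
  shows "computable (\<lambda>e. f (\<lambda>i. s i e))"
proof -
  obtain n g where g: "recursive n g" "\<And>e. g (map e [0..<n]) = f e"
    using f by (auto simp: computable_def)
  have "\<exists>k. \<forall>m\<ge>k. \<exists>h. recursive m h \<and> (\<forall>e. h (map e [0..<m]) = s i e)" for i
    using computable_large[OF s] by metis
  then obtain k where
    k: "\<And>i m. k i \<le> m \<Longrightarrow> \<exists>h. recursive m h \<and> (\<forall>e. h (map e [0..<m]) = s i e)"
    by metis
  define m where "m = (\<Sum>i<n. k i)"
  have "\<exists>h. recursive m h \<and> (\<forall>e. h (map e [0..<m]) = s i e)" if "i < n" for i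
    using k that unfolding m_def by (auto intro!: k member_le_sum)
  then obtain h where h: "\<And>i. i < n \<Longrightarrow> recursive m (h i)"
    "\<And>i e. i < n \<Longrightarrow> h i (map e [0..<m]) = s i e" by metis
  let ?gs = "map h [0..<n]"
  have "recursive m (\<lambda>xs. g (map (\<lambda>k. k xs) ?gs))"
    using g h by (intro recursive.comp) auto
  moreover have "map (\<lambda>k. k (map e [0..<m])) ?gs = map (\<lambda>i. s i e) [0..<n]" for e
    using h by auto
  ultimately show ?thesis
    unfolding computable_def
    by (intro exI[of _ m] exI[of _ "\<lambda>xs. g (map (\<lambda>k. k xs) ?gs)"]) (simp add: g del: map_map)
qed

lemma computable_var [intro]: "computable (\<lambda>e. e i)"
  unfolding computable_def
  by (intro exI[of _ "Suc i"] exI[of _ "\<lambda>xs. xs ! i"]) (auto intro: recursive.proj simp del: upt_Suc)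

lemma computable_0: "computable (\<lambda>e. 0)"
  unfolding computable_def by (auto intro: recursive.zero)

lemma computable_call1:
  assumes "computable (\<lambda>e. F (e 0))" "computable f"
  shows "computable (\<lambda>e. F (f e))"
  using computable_subst[OF assms(1), of "\<lambda>i. f"] assms(2) by simp

lemma computable_call2:
  assumes "computable (\<lambda>e. F (e 0) (e 1))" "computable f" "computable g"
  shows "computable (\<lambda>e. F (f e) (g e))"
proof -
  let ?s = "\<lambda>i :: nat. if i = 0 then f else g"
  have "computable (?s i)" for i using assms by auto
  from computable_subst[OF assms(1), of ?s, OF this] show ?thesis by simp
qed

lemma computable_Suc:
  assumes "computable f"
  shows "computable (\<lambda>e. Suc (f e))"
proof (rule computable_call1[OF _ assms])
  show "computable (\<lambda>e. Suc (e 0))"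
    unfolding computable_def
    by (intro exI[of _ 1] exI[of _ "\<lambda>xs. Suc (xs ! 0)"]) (use recursive.succ in auto)
qed

lemma computable_shifted:
  assumes "computable (\<lambda>e. f (e 0) (\<lambda>i. e (Suc i)))" "computable k"
  shows "computable (\<lambda>e. f (k e) e)"
proof -
  let ?s = "\<lambda>i. case i of 0 \<Rightarrow> k | Suc j \<Rightarrow> \<lambda>e. e j"
  have "computable (?s i)" for i
    using assms(2) by (cases i) auto
  from computable_subst[OF assms(1), of ?s, OF this] show ?thesis by simp
qed

lemma map_upt_Suc': "map e [0..<Suc n] = e 0 # map (\<lambda>i. e (Suc i)) [0..<n]"
  by (simp add: map_upt_Suc del: upt_Suc)

lemma computable_rec_nat:
  assumes f: "computable f" and g: "computable (\<lambda>e. g (e 0) (e (Suc 0)) (\<lambda>i. e (Suc (Suc i))))"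
    and k: "computable k"
  shows "computable (\<lambda>e. rec_nat (f e) (\<lambda>y r. g y r e) (k e))"
proof (rule computable_shifted[OF _ k])
  obtain n1 where n1: "\<And>m. n1 \<le> m \<Longrightarrow> \<exists>h. recursive m h \<and> (\<forall>e. h (map e [0..<m]) = f e)"
    using computable_large[OF f] by blast
  obtain n2 where n2: "\<And>m. n2 \<le> m \<Longrightarrow> \<exists>h. recursive m h \<and>
      (\<forall>e. h (map e [0..<m]) = g (e 0) (e (Suc 0)) (\<lambda>i. e (Suc (Suc i))))"
    using computable_large[OF g] by blast
  define m where "m = n1 + n2"
  obtain f' where f': "recursive m f'" "\<And>e. f' (map e [0..<m]) = f e"
    using n1[of m] by (auto simp: m_def)
  obtain g' where g': "recursive (Suc (Suc m)) g'"
    "\<And>e. g' (map e [0..<Suc (Suc m)]) = g (e 0) (e (Suc 0)) (\<lambda>i. e (Suc (Suc i)))"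
    using n2[of "Suc (Suc m)"] by (auto simp: m_def simp del: upt_Suc)
  have g'': "g' (y # r # map e [0..<m]) = g y r e" for y r e
    using g'(2)[of "case_nat y (case_nat r e)"] by (simp add: map_upt_Suc' del: upt_Suc)
  have "recursive (Suc m) (\<lambda>xs. rec_nat (f' (tl xs)) (\<lambda>y r. g' (y # r # tl xs)) (hd xs))"
    using f'(1) g'(1) by (rule recursive.prec)
  then show "computable (\<lambda>e. rec_nat (f (\<lambda>i. e (Suc i))) (\<lambda>y r. g y r (\<lambda>i. e (Suc i))) (e 0))"
    unfolding computable_def
    by (intro exI conjI) (auto simp: map_upt_Suc' f' g'' simp del: upt_Suc)
qed

lemma computable_Least_zero:
  assumes f: "computable (\<lambda>e. f (e 0) (\<lambda>i. e (Suc i)))" and ex: "\<And>e. \<exists>y. f y e = 0"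
  shows "computable (\<lambda>e. LEAST y. f y e = (0 :: nat))"
proof -
  obtain n where n: "\<And>m. n \<le> m \<Longrightarrow> \<exists>h. recursive m h \<and>
      (\<forall>e. h (map e [0..<m]) = f (e 0) (\<lambda>i. e (Suc i)))"
    using computable_large[OF f] by blast
  obtain g where g: "recursive (Suc n) g"
    "\<And>e. g (map e [0..<Suc n]) = f (e 0) (\<lambda>i. e (Suc i))"
    using n[of "Suc n"] by (auto simp del: upt_Suc)
  have g': "g (y # map e [0..<n]) = f y e" for y e
    using g(2)[of "case_nat y e"] by (simp add: map_upt_Suc' del: upt_Suc)
  have "\<exists>y. g (y # xs) = 0" if "length xs = n" for xs
    using ex[of "\<lambda>i. xs ! i"] g'[of _ "\<lambda>i. xs ! i"] that by (auto simp: map_nth)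
  then have "recursive n (\<lambda>xs. LEAST y. g (y # xs) = 0)"
    using g(1) by (intro recursive.minim) auto
  then show ?thesis
    unfolding computable_def by (intro exI conjI) (auto simp: g')
qed

lemma computable_const: "computable (\<lambda>e. c)"
  by (induction c) (auto intro: computable_0 computable_Suc)

lemma computable_add:
  assumes "computable f" "computable g"
  shows "computable (\<lambda>e. f e + g e)"
proof -
  have "computable (\<lambda>e. rec_nat (f e) (\<lambda>y r. Suc r) (g e))"
    by (intro computable_rec_nat assms computable_Suc computable_var)
  moreover have "rec_nat a (\<lambda>y r. Suc r) b = a + b" for a b by (induction b) auto
  ultimately show ?thesis by simp
qed

lemma computable_mult:
  assumes "computable f" "computable g"
  shows "computable (\<lambda>e. f e * g e)"
proof -
  have "computable (\<lambda>e. rec_nat 0 (\<lambda>y r. r + e 0) (e 1))"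
    by (intro computable_rec_nat computable_add computable_const computable_var)
  moreover have "rec_nat 0 (\<lambda>y r. r + a) b = a * b" for a b :: nat by (induction b) auto
  ultimately have "computable (\<lambda>e. e 0 * e 1)" by simp
  from computable_call2[OF this assms] show ?thesis .
qed

lemma computable_power:
  assumes "computable f" "computable g"
  shows "computable (\<lambda>e. f e ^ g e)"
proof -
  have "computable (\<lambda>e. rec_nat 1 (\<lambda>y r. r * e 0) (e 1))"
    by (intro computable_rec_nat computable_mult computable_const computable_var)
  moreover have "rec_nat 1 (\<lambda>y r. r * a) b = a ^ b" for a b :: nat by (induction b) auto
  ultimately have "computable (\<lambda>e. e 0 ^ e 1)" by simp
  from computable_call2[OF this assms] show ?thesis .
qed

lemma computable_diff:
  assumes "computable f" "computable g"
  shows "computable (\<lambda>e. f e - g e)"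
proof -
  have "computable (\<lambda>e. rec_nat 0 (\<lambda>y r. y) (e 0))"
    by (intro computable_rec_nat computable_const computable_var)
  moreover have "rec_nat 0 (\<lambda>y r. y) b = b - 1" for b :: nat by (cases b) auto
  ultimately have pred: "computable (\<lambda>e. e 0 - 1)" by simp
  have "computable (\<lambda>e. rec_nat (e 0) (\<lambda>y r. r - 1) (e 1))"
    by (intro computable_rec_nat computable_call1[OF pred] computable_var)
  moreover have "rec_nat a (\<lambda>y r. r - 1) b = a - b" for a b :: nat by (induction b) auto
  ultimately have "computable (\<lambda>e. e 0 - e 1)" by simp
  from computable_call2[OF this assms] show ?thesis .
qed

lemma computable_pred_le:
  assumes "computable f" "computable g"
  shows "computable_pred (\<lambda>e. f e \<le> g e)"
proof -
  have "computable (\<lambda>e. 1 - (f e - g e))"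
    by (intro computable_diff computable_const assms)
  then show ?thesis unfolding computable_pred_def by (rule computable_cong) auto
qed

lemma computable_pred_not:
  assumes "computable_pred P"
  shows "computable_pred (\<lambda>e. \<not> P e)"
proof -
  have "computable (\<lambda>e. 1 - (if P e then 1 else 0))"
    by (intro computable_diff computable_const assms[unfolded computable_pred_def])
  then show ?thesis unfolding computable_pred_def by (rule computable_cong) auto
qed

lemma computable_pred_conj:
  assumes "computable_pred P" "computable_pred Q"
  shows "computable_pred (\<lambda>e. P e \<and> Q e)"
proof -
  have "computable (\<lambda>e. (if P e then 1 else 0) * (if Q e then 1 else 0))"
    by (intro computable_mult assms[unfolded computable_pred_def])
  then show ?thesis unfolding computable_pred_def by (rule computable_cong) auto
qed

lemma computable_pred_disj:
  assumes "computable_pred P" "computable_pred Q"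
  shows "computable_pred (\<lambda>e. P e \<or> Q e)"
  using computable_pred_not[OF computable_pred_conj[OF assms[THEN computable_pred_not]]] by simp

lemma computable_pred_eq:
  assumes "computable f" "computable g"
  shows "computable_pred (\<lambda>e. f e = g e)"
  using computable_pred_conj[OF computable_pred_le[OF assms] computable_pred_le[OF assms(2,1)]]
  by (simp add: eq_iff)

lemma computable_pred_less:
  assumes "computable f" "computable g"
  shows "computable_pred (\<lambda>e. f e < g e)"
  using computable_pred_not[OF computable_pred_le[OF assms(2,1)]] by (simp add: not_le)

lemma computable_if:
  assumes "computable_pred P" "computable f" "computable g"
  shows "computable (\<lambda>e. if P e then f e else g e)"
proof -
  have "computable (\<lambda>e. (if P e then 1 else 0) * f e + (if \<not> P e then 1 else 0) * g e)"
    by (intro computable_add computable_mult assms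
        assms(1)[unfolded computable_pred_def]
        computable_pred_not[OF assms(1), unfolded computable_pred_def])
  then show ?thesis by (rule computable_cong) auto
qed

lemma computable_pred_bex:
  assumes "computable k" "computable_pred (\<lambda>e. P (e 0) (\<lambda>i. e (Suc i)))"
  shows "computable_pred (\<lambda>e. \<exists>y<k e. P y e)"
proof -
  have "computable (\<lambda>e. rec_nat 0 (\<lambda>y r. if P y e then 1 else r) (k e))"
  proof (intro computable_rec_nat computable_const computable_if computable_var assms(1))
    let ?s = "\<lambda>i e :: nat \<Rightarrow> nat. case i of 0 \<Rightarrow> e 0 | Suc j \<Rightarrow> e (Suc (Suc j))"
    have "computable (?s i)" for i
      by (cases i) auto
    from computable_subst[OF assms(2)[unfolded computable_pred_def], of ?s, OF this]
    show "computable_pred (\<lambda>e. P (e 0) (\<lambda>i. e (Suc (Suc i))))"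
      unfolding computable_pred_def by simp
  qed
  moreover have "rec_nat 0 (\<lambda>y r. if Q y then 1 else r) b = (if \<exists>y<b. Q y then 1 else (0::nat))"
    for b :: nat and Q
    by (induction b) (auto simp: less_Suc_eq)
  ultimately show ?thesis unfolding computable_pred_def by simp
qed

lemma computable_pred_ball:
  assumes "computable k" "computable_pred (\<lambda>e. P (e 0) (\<lambda>i. e (Suc i)))"
  shows "computable_pred (\<lambda>e. \<forall>y<k e. P y e)"
  using computable_pred_not[OF computable_pred_bex[OF assms(1) computable_pred_not[OF assms(2)]]]
  by simp

lemma computable_Least:
  assumes "computable_pred (\<lambda>e. P (e 0) (\<lambda>i. e (Suc i)))" "\<And>e. \<exists>y. P y e"
  shows "computable (\<lambda>e. LEAST y. P y e)"
proof -
  have "computable (\<lambda>e. LEAST y. (if \<not> P y e then 1 else 0) = (0 :: nat))"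
    using assms(2) computable_pred_not[OF assms(1), unfolded computable_pred_def]
    by (intro computable_Least_zero) auto
  then show ?thesis by (rule computable_cong) (auto intro!: arg_cong[of _ _ Least])
qed

lemma computable_pred_call2:
  assumes "computable_pred (\<lambda>e. P (e 0) (e 1))" "computable f" "computable g"
  shows "computable_pred (\<lambda>e. P (f e) (g e))"
  using assms unfolding computable_pred_def by (rule computable_call2)

lemmas computable_intros =
  computable_const computable_var computable_Suc computable_add computable_mult computable_diff
  computable_power computable_if computable_pred_le computable_pred_less computable_pred_eq
  computable_pred_not computable_pred_conj computable_pred_disj computable_pred_bex
  computable_pred_ball

lemma computable_div:
  assumes "computable f" "computable g"
  shows "computable (\<lambda>e. f e div g e)"
proof -
  have "computable (\<lambda>e. LEAST q. e 1 = 0 \<or> e 0 < e 1 * Suc q)"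
  proof (intro computable_Least computable_intros)
    fix e :: "nat \<Rightarrow> nat"
    show "\<exists>q. e 1 = 0 \<or> e 0 < e 1 * Suc q"
      by (intro exI[of _ "e 0"]) (cases "e 1", auto)
  qed
  moreover have "(LEAST q. b = 0 \<or> a < b * Suc q) = a div b" for a b :: nat
  proof (rule Least_equality)
    show "b = 0 \<or> a < b * Suc (a div b)"
      by (metis bot_nat_0.not_eq_extremum dividend_less_times_div mult_Suc_right)
  next
    fix q assume "b = 0 \<or> a < b * Suc q"
    then show "a div b \<le> q"
      by (cases "b = 0") (auto simp: less_mult_imp_div_less mult.commute simp flip: less_Suc_eq_le)
  qed
  ultimately have "computable (\<lambda>e. e 0 div e 1)" by simp
  from computable_call2[OF this assms] show ?thesis .
qed

lemma computable_mod:
  assumes "computable f" "computable g"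
  shows "computable (\<lambda>e. f e mod g e)"
proof -
  have "computable (\<lambda>e. f e - g e * (f e div g e))"
    by (intro computable_intros computable_div assms)
  then show ?thesis by (simp add: minus_mult_div_eq_mod)
qed

lemma computable_prod_encode:
  assumes "computable f" "computable g"
  shows "computable (\<lambda>e. prod_encode (f e, g e))"
  unfolding prod_encode_def triangle_def prod.case
  by (intro computable_intros computable_div assms)

lemma add_le_prod_encode: "m + n \<le> prod_encode (m, n)"
proof -
  have "k \<le> triangle k" for k by (induction k) auto
  from this[of "m + n"] show ?thesis by (simp add: prod_encode_def)
qed

abbreviation pfst :: "nat \<Rightarrow> nat" where "pfst z \<equiv> fst (prod_decode z)"
abbreviation psnd :: "nat \<Rightarrow> nat" where "psnd z \<equiv> snd (prod_decode z)"

lemma pfst_add_psnd_le: "pfst z + psnd z \<le> z"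
  using add_le_prod_encode[of "pfst z" "psnd z"] by simp

lemma computable_pfst:
  assumes "computable f"
  shows "computable (\<lambda>e. pfst (f e))"
proof (rule computable_call1[OF _ assms])
  have eq: "(LEAST m. \<exists>n<Suc z. prod_encode (m, n) = z) = pfst z" for z
    by (rule Least_equality)
      (use pfst_add_psnd_le[of z] in \<open>auto intro!: exI[of _ "psnd z"]\<close>)
  have "computable (\<lambda>e. LEAST m. \<exists>n<Suc (e 0). prod_encode (m, n) = e 0)"
  proof (intro computable_Least computable_intros computable_prod_encode)
    show "\<exists>m. \<exists>n<Suc (e 0). prod_encode (m, n) = e 0" for e :: "nat \<Rightarrow> nat"
      using pfst_add_psnd_le[of "e 0"]
      by (intro exI[of _ "pfst (e 0)"] exI[of _ "psnd (e 0)"]) auto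
  qed
  then show "computable (\<lambda>e. pfst (e 0))" by (simp add: eq)
qed

lemma computable_psnd:
  assumes "computable f"
  shows "computable (\<lambda>e. psnd (f e))"
proof (rule computable_call1[OF _ assms])
  have eq: "(LEAST n. prod_encode (pfst z, n) = z) = psnd z" for z
  proof (rule Least_equality)
    fix n assume "prod_encode (pfst z, n) = z"
    then have "prod_decode z = (pfst z, n)" by (metis prod_encode_inverse)
    then show "psnd z \<le> n" by (metis order_refl snd_conv)
  qed simp
  have "computable (\<lambda>e. LEAST n. prod_encode (pfst (e 0), n) = e 0)"
  proof (intro computable_Least computable_intros computable_prod_encode computable_pfst)
    show "\<exists>n. prod_encode (pfst (e 0), n) = e 0" for e :: "nat \<Rightarrow> nat"
      by (intro exI[of _ "psnd (e 0)"]) auto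
  qed
  then show "computable (\<lambda>e. psnd (e 0))" by (simp add: eq)
qed

lemma computable_pred_set_decode:
  assumes "computable f" "computable g"
  shows "computable_pred (\<lambda>e. f e \<in> set_decode (g e))"
proof -
  have "computable_pred (\<lambda>e. g e div 2 ^ f e mod 2 = 1)"
    by (intro computable_intros computable_div computable_mod assms)
  then show ?thesis by (simp add: set_decode_def odd_iff_mod_2_eq_one)
qed

lemmas computable_intros' =
  computable_intros computable_div computable_mod computable_prod_encode computable_pfst
  computable_psnd computable_pred_set_decode

lemma decidable_if_computable_pred:
  assumes "computable_pred (\<lambda>e. P (e 0))"
  shows "decidable {n. P n}"
proof -
  obtain n where n: "\<And>m. n \<le> m \<Longrightarrow> \<exists>g. recursive m g \<and>
      (\<forall>e. g (map e [0..<m]) = (if P (e 0) then 1 else 0))"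
    using computable_large[OF assms[unfolded computable_pred_def]] by blast
  obtain g where g: "recursive (Suc n) g"
    "\<And>e. g (map e [0..<Suc n]) = (if P (e 0) then 1 else 0)"
    using n[of "Suc n"] by (auto simp del: upt_Suc)
  let ?gs = "(\<lambda>xs :: nat list. xs ! 0) # replicate n (\<lambda>xs. 0)"
  have "recursive 1 (\<lambda>xs. g (map (\<lambda>h. h xs) ?gs))"
    using g(1) by (intro recursive.comp) (auto intro: recursive.proj recursive.zero)
  moreover have "g (map (\<lambda>h. h [x]) ?gs) = (if P x then 1 else 0)" for x
  proof -
    have "map (\<lambda>h. h [x]) ?gs = map (case_nat x (\<lambda>i. 0)) [0..<Suc n]"
      by (auto simp: map_upt_Suc' map_replicate_const simp del: upt_Suc)
    then show ?thesis using g(2)[of "case_nat x (\<lambda>i. 0)"] by simp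
  qed
  ultimately show ?thesis unfolding decidable_def
    by (intro exI[of _ "\<lambda>xs. g (map (\<lambda>h. h xs) ?gs)"] conjI) auto
qed

text \<open>Course-of-values recursion: \<open>Q x W\<close> decides \<open>x\<close> from the code \<open>W\<close> of the
  set of all smaller numbers that satisfy the predicate.\<close>

definition cov_table :: "(nat \<Rightarrow> nat \<Rightarrow> bool) \<Rightarrow> nat \<Rightarrow> nat" where
  "cov_table Q = rec_nat 0 (\<lambda>y r. if Q y r then 2 ^ y + r else r)"

definition cov :: "(nat \<Rightarrow> nat \<Rightarrow> bool) \<Rightarrow> nat \<Rightarrow> bool" where
  "cov Q x \<longleftrightarrow> Q x (cov_table Q x)"

lemma cov_table_eq: "cov_table Q x = set_encode {k. k < x \<and> cov Q k}"
proof (induction x)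
  case (Suc x)
  have eq: "{k. k < Suc x \<and> cov Q k} =
      (if cov Q x then insert x {k. k < x \<and> cov Q k} else {k. k < x \<and> cov Q k})"
    by (auto simp: less_Suc_eq)
  have rec: "cov_table Q (Suc x) = (if cov Q x then 2 ^ x + cov_table Q x else cov_table Q x)"
    by (simp add: cov_table_def cov_def)
  show ?case
    unfolding eq rec by (subst (1) Suc.IH)+ (auto simp: Suc.IH)
qed (simp add: cov_table_def)

lemma set_decode_cov_table: "set_decode (cov_table Q x) = {k. k < x \<and> cov Q k}"
  by (simp add: cov_table_eq)

lemma cov_rec: "cov Q x \<longleftrightarrow> Q x (cov_table Q x)"
  by (simp add: cov_def)

lemma computable_pred_cov:
  assumes Q: "computable_pred (\<lambda>e. Q (\<lambda>i. e (Suc (Suc i))) (e 0) (e (Suc 0)))"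
    and f: "computable f"
  shows "computable_pred (\<lambda>e. cov (Q e) (f e))"
proof -
  have W: "computable (\<lambda>e. cov_table (Q e) (f e))" if "computable f" for f
    unfolding cov_table_def
    by (intro computable_rec_nat computable_intros Q that)
  let ?s = "\<lambda>i e. case i of 0 \<Rightarrow> f e | Suc 0 \<Rightarrow> cov_table (Q e) (f e) | Suc (Suc j) \<Rightarrow> e j"
  have "computable (?s i)" for i
    using f W[OF f] by (cases i; cases "i - 1") auto
  from computable_subst[OF Q[unfolded computable_pred_def], of ?s, OF this]
  show ?thesis unfolding computable_pred_def cov_def by simp
qed

section \<open>Deciding sentences whose quantifiers can be bounded\<close>

lemma code_less:
  "a < prod_encode (Suc 0, prod_encode (a, b))" "b < prod_encode (Suc 0, prod_encode (a, b))"
  "a < prod_encode (2, a)"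
  "a < prod_encode (3, prod_encode (a, b))" "b < prod_encode (3, prod_encode (a, b))"
  "b < prod_encode (4, prod_encode (i, b))"
  using add_le_prod_encode[of "Suc 0" "prod_encode (a, b)"] add_le_prod_encode[of 2 a]
    add_le_prod_encode[of 3 "prod_encode (a, b)"] add_le_prod_encode[of 4 "prod_encode (i, b)"]
    add_le_prod_encode[of a b] add_le_prod_encode[of i b]
  by linarith+

definition tm_step :: "nat \<Rightarrow> nat \<Rightarrow> bool" where
  "tm_step x W \<longleftrightarrow> pfst x = 0 \<or> (pfst x = 1 \<and>
     pfst (psnd x) \<in> set_decode W \<and> psnd (psnd x) \<in> set_decode W)"

definition fm_step :: "nat \<Rightarrow> nat \<Rightarrow> bool" where
  "fm_step x W \<longleftrightarrow>
     (pfst x \<le> 1 \<and> cov tm_step (pfst (psnd x)) \<and> cov tm_step (psnd (psnd x))) \<or>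
     (pfst x = 2 \<and> psnd x \<in> set_decode W) \<or>
     (pfst x = 3 \<and> pfst (psnd x) \<in> set_decode W \<and> psnd (psnd x) \<in> set_decode W) \<or>
     (pfst x = 4 \<and> psnd (psnd x) \<in> set_decode W)"

definition tm_vars_step :: "nat \<Rightarrow> nat \<Rightarrow> nat \<Rightarrow> bool" where
  "tm_vars_step i x W \<longleftrightarrow> (pfst x = 0 \<and> psnd x = i) \<or> (pfst x = 1 \<and>
     (pfst (psnd x) \<in> set_decode W \<or> psnd (psnd x) \<in> set_decode W))"

definition free_vars_step :: "nat \<Rightarrow> nat \<Rightarrow> nat \<Rightarrow> bool" where
  "free_vars_step i x W \<longleftrightarrow>
     (pfst x \<le> 1 \<and> (cov (tm_vars_step i) (pfst (psnd x)) \<or> cov (tm_vars_step i) (psnd (psnd x)))) \<or>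
     (pfst x = 2 \<and> psnd x \<in> set_decode W) \<or>
     (pfst x = 3 \<and> (pfst (psnd x) \<in> set_decode W \<or> psnd (psnd x) \<in> set_decode W)) \<or>
     (pfst x = 4 \<and> pfst (psnd x) \<noteq> i \<and> psnd (psnd x) \<in> set_decode W)"

text \<open>The guards \<open>< x\<close> reflect that the table holds only smaller numbers; on
  codes, \<open>code_less\<close> discharges them.\<close>

lemma cov_tm_step_iff:
  "cov tm_step x \<longleftrightarrow> pfst x = 0 \<or> (pfst x = 1 \<and>
     pfst (psnd x) < x \<and> cov tm_step (pfst (psnd x)) \<and>
     psnd (psnd x) < x \<and> cov tm_step (psnd (psnd x)))"
  by (subst cov_rec, subst tm_step_def) (simp add: set_decode_cov_table)

lemma cov_fm_step_iff:
  "cov fm_step x \<longleftrightarrow>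
     (pfst x \<le> 1 \<and> cov tm_step (pfst (psnd x)) \<and> cov tm_step (psnd (psnd x))) \<or>
     (pfst x = 2 \<and> psnd x < x \<and> cov fm_step (psnd x)) \<or>
     (pfst x = 3 \<and> pfst (psnd x) < x \<and> cov fm_step (pfst (psnd x)) \<and>
        psnd (psnd x) < x \<and> cov fm_step (psnd (psnd x))) \<or>
     (pfst x = 4 \<and> psnd (psnd x) < x \<and> cov fm_step (psnd (psnd x)))"
  by (subst cov_rec, subst fm_step_def) (simp add: set_decode_cov_table)

lemma cov_tm_vars_step_iff:
  "cov (tm_vars_step i) x \<longleftrightarrow> (pfst x = 0 \<and> psnd x = i) \<or> (pfst x = 1 \<and>
     (pfst (psnd x) < x \<and> cov (tm_vars_step i) (pfst (psnd x)) \<or>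
      psnd (psnd x) < x \<and> cov (tm_vars_step i) (psnd (psnd x))))"
  by (subst cov_rec, subst tm_vars_step_def) (simp add: set_decode_cov_table)

lemma cov_free_vars_step_iff:
  "cov (free_vars_step i) x \<longleftrightarrow>
     (pfst x \<le> 1 \<and> (cov (tm_vars_step i) (pfst (psnd x)) \<or> cov (tm_vars_step i) (psnd (psnd x)))) \<or>
     (pfst x = 2 \<and> psnd x < x \<and> cov (free_vars_step i) (psnd x)) \<or>
     (pfst x = 3 \<and> (pfst (psnd x) < x \<and> cov (free_vars_step i) (pfst (psnd x)) \<or>
        psnd (psnd x) < x \<and> cov (free_vars_step i) (psnd (psnd x)))) \<or>
     (pfst x = 4 \<and> pfst (psnd x) \<noteq> i \<and> psnd (psnd x) < x \<and> cov (free_vars_step i) (psnd (psnd x)))"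
  by (subst cov_rec, subst free_vars_step_def) (simp add: set_decode_cov_table)

lemma cov_tm_step_code: "cov tm_step (tm_code t)"
proof (induction t)
  case (Var i)
  show ?case by (subst cov_tm_step_iff) simp
next
  case (Plus s t)
  then show ?case by (subst cov_tm_step_iff) (simp add: code_less)
qed

lemma cov_tm_step_imp: "cov tm_step x \<Longrightarrow> \<exists>t. tm_code t = x"
proof (induction x rule: less_induct)
  case (less x)
  obtain k y where x: "x = prod_encode (k, y)" by (metis prod_decode_inverse surj_pair)
  obtain a b where y: "y = prod_encode (a, b)" by (metis prod_decode_inverse surj_pair)
  from less.prems consider "k = 0" | "k = 1" "a < x" "cov tm_step a" "b < x" "cov tm_step b"
    by (subst (asm) cov_tm_step_iff) (auto simp: x y)
  then show ?case
  proof cases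
    case 1
    then show ?thesis by (intro exI[of _ "Var y"]) (simp add: x)
  next
    case 2
    then obtain s t where "tm_code s = a" "tm_code t = b" using less.IH by blast
    then show ?thesis using 2 by (intro exI[of _ "Plus s t"]) (simp add: x y)
  qed
qed

lemma cov_fm_step_code: "cov fm_step (fm_code p)"
proof (induction p)
  case (Eq s t)
  show ?case by (subst cov_fm_step_iff) (simp add: cov_tm_step_code)
next
  case (Rel s t)
  show ?case by (subst cov_fm_step_iff) (simp add: cov_tm_step_code)
next
  case (Neg p)
  then show ?case by (subst cov_fm_step_iff) (simp add: code_less)
next
  case (Conj p q)
  then show ?case by (subst cov_fm_step_iff) (simp add: code_less)
next
  case (Ex i p)
  then show ?case by (subst cov_fm_step_iff) (simp add: code_less)
qed

lemma cov_fm_step_imp: "cov fm_step x \<Longrightarrow> \<exists>p. fm_code p = x"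
proof (induction x rule: less_induct)
  case (less x)
  obtain k y where x: "x = prod_encode (k, y)" by (metis prod_decode_inverse surj_pair)
  obtain a b where y: "y = prod_encode (a, b)" by (metis prod_decode_inverse surj_pair)
  from less.prems consider "k \<le> 1" "cov tm_step a" "cov tm_step b" | "k = 2" "y < x" "cov fm_step y"
    | "k = 3" "a < x" "cov fm_step a" "b < x" "cov fm_step b" | "k = 4" "b < x" "cov fm_step b"
    by (subst (asm) cov_fm_step_iff) (auto simp: x y)
  then show ?case
  proof cases
    case 1
    then obtain s t where st: "tm_code s = a" "tm_code t = b" using cov_tm_step_imp by blast
    consider "k = 0" | "k = 1" using 1 by linarith
    then show ?thesis
      using st by cases (auto simp: x y intro: exI[of _ "Eq s t"] exI[of _ "Rel s t"])
  next
    case 2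
    then obtain p where "fm_code p = y" using less.IH by blast
    then show ?thesis using 2 by (intro exI[of _ "Neg p"]) (simp add: x)
  next
    case 3
    then obtain p q where "fm_code p = a" "fm_code q = b" using less.IH by blast
    then show ?thesis using 3 by (intro exI[of _ "Conj p q"]) (simp add: x y)
  next
    case 4
    then obtain p where "fm_code p = b" using less.IH by blast
    then show ?thesis using 4 by (intro exI[of _ "Ex a p"]) (simp add: x y)
  qed
qed

lemma cov_tm_vars_step: "cov (tm_vars_step i) (tm_code t) \<longleftrightarrow> i \<in> tm_vars t"
proof (induction t)
  case (Var j)
  show ?case by (subst cov_tm_vars_step_iff) auto
next
  case (Plus s t)
  then show ?case by (subst cov_tm_vars_step_iff) (simp add: code_less)
qed

lemma cov_free_vars_step: "cov (free_vars_step i) (fm_code p) \<longleftrightarrow> i \<in> free_vars p"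
proof (induction p)
  case (Eq s t)
  show ?case by (subst cov_free_vars_step_iff) (simp add: cov_tm_vars_step)
next
  case (Rel s t)
  show ?case by (subst cov_free_vars_step_iff) (simp add: cov_tm_vars_step)
next
  case (Neg p)
  then show ?case by (subst cov_free_vars_step_iff) (simp add: code_less)
next
  case (Conj p q)
  then show ?case by (subst cov_free_vars_step_iff) (simp add: code_less)
next
  case (Ex j p)
  then show ?case by (subst cov_free_vars_step_iff) (auto simp: code_less)
qed

lemma pair_le_code: "a \<le> prod_encode (k, prod_encode (a, b))" "b \<le> prod_encode (k, prod_encode (a, b))"
  using add_le_prod_encode[of a b] add_le_prod_encode[of k "prod_encode (a, b)"] by linarith+

lemma tm_vars_le_code: "i \<in> tm_vars t \<Longrightarrow> i \<le> tm_code t"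
proof (induction t)
  case (Var j)
  then show ?case using add_le_prod_encode[of 0 j] by simp
next
  case (Plus s t)
  then show ?case using pair_le_code[where a = "tm_code s" and b = "tm_code t" and k = 1] by auto
qed

lemma free_vars_le_code: "i \<in> free_vars p \<Longrightarrow> i \<le> fm_code p"
proof (induction p)
  case (Eq s t)
  then show ?case
    using tm_vars_le_code[of i s] tm_vars_le_code[of i t] pair_le_code[where a = "tm_code s" and b = "tm_code t" and k = 0]
    by auto
next
  case (Rel s t)
  then show ?case
    using tm_vars_le_code[of i s] tm_vars_le_code[of i t] pair_le_code[where a = "tm_code s" and b = "tm_code t" and k = 1]
    by auto
next
  case (Neg p)
  then show ?case using code_less(3)[of "fm_code p"] by auto
next
  case (Conj p q)
  then show ?case using pair_le_code[where a = "fm_code p" and b = "fm_code q" and k = 3] by auto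
next
  case (Ex j p)
  then show ?case using pair_le_code[where a = j and b = "fm_code p" and k = 4] by auto
qed

lemma tm_val_cong: "(\<And>i. i \<in> tm_vars t \<Longrightarrow> e i = e' i) \<Longrightarrow> tm_val e t = tm_val e' t"
  by (induction t) auto

lemma sat_cong: "(\<And>i. i \<in> free_vars p \<Longrightarrow> e i = e' i) \<Longrightarrow> sat R e p \<longleftrightarrow> sat R e' p"
proof (induction p arbitrary: e e')
  case (Eq s t)
  then have "tm_val e s = tm_val e' s" "tm_val e t = tm_val e' t" by (auto intro: tm_val_cong)
  then show ?case by simp
next
  case (Rel s t)
  then have "tm_val e s = tm_val e' s" "tm_val e t = tm_val e' t" by (auto intro: tm_val_cong)
  then show ?case by simp
next
  case (Neg p)
  have "sat R e p \<longleftrightarrow> sat R e' p" by (rule Neg.IH) (use Neg.prems in auto)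
  then show ?case by simp
next
  case (Conj p q)
  have "sat R e p \<longleftrightarrow> sat R e' p" by (rule Conj.IH) (use Conj.prems in auto)
  moreover have "sat R e q \<longleftrightarrow> sat R e' q" by (rule Conj.IH) (use Conj.prems in auto)
  ultimately show ?case by simp
next
  case (Ex i p)
  have "sat R (e(i := n)) p \<longleftrightarrow> sat R (e'(i := n)) p" for n
    by (rule Ex.IH) (use Ex.prems in auto)
  then show ?case by simp
qed

lemma sentence_true_iff:
  "p \<in> true_sentences R \<longleftrightarrow> free_vars p = {} \<and> sat R (\<lambda>_. 0) p"
proof -
  have "sat R e p \<longleftrightarrow> sat R (\<lambda>_. 0) p" if "free_vars p = {}" for e
    using that by (intro sat_cong) simp
  then show ?thesis unfolding true_sentences_def sentence_def by blast
qed

section \<open>Evaluating coded formulas in coded environments\<close>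

text \<open>A number codes the environment of its base-\<open>M\<close> digits.\<close>

definition digit :: "nat \<Rightarrow> nat \<Rightarrow> nat \<Rightarrow> nat" where
  "digit M e j = e div M ^ j mod M"

lemma digit_eq_0:
  assumes "M > 0" "e < M ^ k" "k \<le> j"
  shows "digit M e j = 0"
proof -
  have "e < M ^ j" using assms power_increasing[of k j M] by linarith
  then show ?thesis by (simp add: digit_def)
qed

lemma exists_digits:
  assumes "\<And>j. j < k \<Longrightarrow> f j < M"
  shows "\<exists>e<M ^ k. \<forall>j<k. digit M e j = f j"
  using assms
proof (induction k)
  case (Suc k)
  then obtain e where e: "e < M ^ k" "\<And>j. j < k \<Longrightarrow> digit M e j = f j" by force
  have fk: "f k < M" using Suc.prems by simp
  define e' where "e' = e + f k * M ^ k"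
  have "e' < (f k + 1) * M ^ k" using e(1) by (simp add: e'_def)
  also have "\<dots> \<le> M * M ^ k" using fk by (intro mult_right_mono) auto
  finally have "e' < M ^ Suc k" by simp
  moreover have "digit M e' j = f j" if "j < Suc k" for j
  proof (cases "j = k")
    case True
    then show ?thesis using e(1) fk by (simp add: e'_def digit_def)
  next
    case False
    then have j: "j < k" using that by simp
    have "M ^ k = M ^ j * M * M ^ (k - Suc j)"
      using j by (metis Suc_leI add_diff_inverse_nat not_less power_Suc2 power_add)
    then have "e' = e + M ^ j * (M * (f k * M ^ (k - Suc j)))"
      by (simp add: e'_def ac_simps)
    moreover have "M ^ j > 0" using fk by simp
    ultimately have "e' div M ^ j = e div M ^ j + M * (f k * M ^ (k - Suc j))" by simp
    then have "digit M e' j = digit M e j" by (simp add: digit_def)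
    then show ?thesis using e(2) j by simp
  qed
  ultimately show ?case by blast
qed auto

text \<open>Course-of-values recursion yields predicates only, so the value of a term enters through
  its graph, on pairs of code and value.\<close>

definition tm_val_step :: "nat \<Rightarrow> nat \<Rightarrow> nat \<Rightarrow> nat \<Rightarrow> bool" where
  "tm_val_step M e x W \<longleftrightarrow>
     (pfst (pfst x) = 0 \<and> psnd x = digit M e (psnd (pfst x))) \<or>
     (pfst (pfst x) = 1 \<and> (\<exists>v<Suc (psnd x).
        prod_encode (pfst (psnd (pfst x)), v) \<in> set_decode W \<and>
        prod_encode (psnd (psnd (pfst x)), psnd x - v) \<in> set_decode W))"

definition has_val :: "nat \<Rightarrow> nat \<Rightarrow> nat \<Rightarrow> nat \<Rightarrow> bool" where
  "has_val M e c v \<longleftrightarrow> cov (tm_val_step M e) (prod_encode (c, v))"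

lemma prod_encode_less:
  assumes "a < c" "v \<le> w"
  shows "prod_encode (a, v) < prod_encode (c, w)"
proof -
  have tri: "triangle m \<le> triangle n" if "m \<le> n" for m n
    using that by (induction n) (auto simp: le_Suc_eq)
  show ?thesis using assms tri[of "a + v" "c + w"] by (simp add: prod_encode_def)
qed

lemma has_val_rec:
  "has_val M e c v \<longleftrightarrow>
     (pfst c = 0 \<and> v = digit M e (psnd c)) \<or>
     (pfst c = 1 \<and> (\<exists>u<Suc v.
        prod_encode (pfst (psnd c), u) < prod_encode (c, v) \<and> has_val M e (pfst (psnd c)) u \<and>
        prod_encode (psnd (psnd c), v - u) < prod_encode (c, v) \<and> has_val M e (psnd (psnd c)) (v - u)))"
  unfolding has_val_def
  by (subst cov_rec, subst tm_val_step_def) (simp add: set_decode_cov_table)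

lemma has_val_iff: "has_val M e (tm_code t) v \<longleftrightarrow> v = tm_val (digit M e) t"
proof (induction t arbitrary: v)
  case (Var i)
  show ?case by (subst has_val_rec) simp
next
  case (Plus s t)
  let ?x = "prod_encode (tm_code (Plus s t), v)"
  have "has_val M e (tm_code (Plus s t)) v \<longleftrightarrow> (\<exists>u<Suc v.
      prod_encode (tm_code s, u) < ?x \<and> has_val M e (tm_code s) u \<and>
      prod_encode (tm_code t, v - u) < ?x \<and> has_val M e (tm_code t) (v - u))"
    by (subst has_val_rec) simp
  also have "\<dots> \<longleftrightarrow> (\<exists>u<Suc v. u = tm_val (digit M e) s \<and> v - u = tm_val (digit M e) t)"
    unfolding Plus.IH by (auto intro!: prod_encode_less simp: code_less)
  also have "\<dots> \<longleftrightarrow> v = tm_val (digit M e) (Plus s t)" by auto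
  finally show ?case .
qed

text \<open>The factor \<open>Suc (tm_code t)\<close> dominates the number of variable occurrences.
  This bounds the search for values in atomic formulas.\<close>

lemma tm_val_le:
  assumes "\<And>j. f j \<le> m"
  shows "tm_val f t \<le> m * Suc (tm_code t)"
proof (induction t)
  case (Var i)
  then show ?case using assms[of i] by (simp add: trans_le_add1)
next
  case (Plus s t)
  have "Suc (tm_code s) + Suc (tm_code t) \<le> Suc (tm_code (Plus s t))"
    using add_le_prod_encode[of "tm_code s" "tm_code t"]
      add_le_prod_encode[of 1 "prod_encode (tm_code s, tm_code t)"] by simp
  then have "m * (Suc (tm_code s) + Suc (tm_code t)) \<le> m * Suc (tm_code (Plus s t))"
    by (rule mult_le_mono2)
  then show ?case using Plus.IH unfolding distrib_left tm_val.simps by linarith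
qed

text \<open>If every existential quantifier in front of a formula with code \<open>c\<close> has a witness of size
  at most \<open>bnd c m\<close> as soon as the parameters are at most \<open>m\<close>, then all values that occur in the
  evaluation of a subformula with code \<open>c\<close> of a sentence with code \<open>c0\<close> may be restricted to
  \<open>level bnd c0 (c0 - c)\<close>.\<close>

definition level :: "(nat \<Rightarrow> nat \<Rightarrow> nat) \<Rightarrow> nat \<Rightarrow> nat \<Rightarrow> nat" where
  "level bnd c0 k = rec_nat 0 (\<lambda>_ h. h + bnd c0 h) k"

definition env_base :: "(nat \<Rightarrow> nat \<Rightarrow> nat) \<Rightarrow> nat \<Rightarrow> nat" where
  "env_base bnd c0 = Suc (level bnd c0 c0)"

text \<open>Variables of a formula with code at most \<open>c0\<close> have indices at most
  \<open>c0\<close>, so \<open>Suc c0\<close> digits suffice.\<close>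

definition env_count :: "(nat \<Rightarrow> nat \<Rightarrow> nat) \<Rightarrow> nat \<Rightarrow> nat" where
  "env_count bnd c0 = env_base bnd c0 ^ Suc c0"

definition sat_rec ::
  "(nat \<times> nat) set \<Rightarrow> (nat \<Rightarrow> nat \<Rightarrow> nat) \<Rightarrow> nat \<Rightarrow> nat \<Rightarrow> nat \<Rightarrow> nat \<Rightarrow> bool" where
  "sat_rec R bnd c0 c e W \<longleftrightarrow>
     (pfst c = 0 \<and> (\<exists>v<Suc (env_base bnd c0 * Suc c0).
        has_val (env_base bnd c0) e (pfst (psnd c)) v \<and>
        has_val (env_base bnd c0) e (psnd (psnd c)) v)) \<or>
     (pfst c = 1 \<and> (\<exists>v<Suc (env_base bnd c0 * Suc c0). \<exists>w<Suc (env_base bnd c0 * Suc c0).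
        has_val (env_base bnd c0) e (pfst (psnd c)) v \<and>
        has_val (env_base bnd c0) e (psnd (psnd c)) w \<and> (v, w) \<in> R)) \<or>
     (pfst c = 2 \<and> \<not> psnd c * env_count bnd c0 + e \<in> set_decode W) \<or>
     (pfst c = 3 \<and> pfst (psnd c) * env_count bnd c0 + e \<in> set_decode W \<and>
        psnd (psnd c) * env_count bnd c0 + e \<in> set_decode W) \<or>
     (pfst c = 4 \<and> (\<exists>e'<env_count bnd c0.
        digit (env_base bnd c0) e' (pfst (psnd c)) \<le> level bnd c0 (c0 - psnd (psnd c)) \<and>
        (\<forall>j<Suc c0. j = pfst (psnd c) \<or> digit (env_base bnd c0) e' j = digit (env_base bnd c0) e j) \<and>
        psnd (psnd c) * env_count bnd c0 + e' \<in> set_decode W))"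

text \<open>A formula code and an environment are packed into one number with the code as the
  leading part. Pairs with a smaller code then come first whatever their environment, as the
  quantifier case requires.\<close>

definition sat_step ::
  "(nat \<times> nat) set \<Rightarrow> (nat \<Rightarrow> nat \<Rightarrow> nat) \<Rightarrow> nat \<Rightarrow> nat \<Rightarrow> nat \<Rightarrow> bool" where
  "sat_step R bnd c0 x W \<longleftrightarrow>
     sat_rec R bnd c0 (x div env_count bnd c0) (x mod env_count bnd c0) W"

lemma level_mono: "k \<le> l \<Longrightarrow> level bnd c0 k \<le> level bnd c0 l"
  by (induction l) (auto simp: level_def le_Suc_eq)

lemma cov_sat_step:
  fixes bnd :: "nat \<Rightarrow> nat \<Rightarrow> nat" and c0 :: nat
  assumes mono: "\<And>c c' m. c \<le> c' \<Longrightarrow> bnd c m \<le> bnd c' m"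
    and witness: "\<And>p i e m n. (\<And>j. e j \<le> m) \<Longrightarrow> sat R (e(i := n)) p \<Longrightarrow>
      \<exists>n\<le>bnd (fm_code p) m. sat R (e(i := n)) p"
    and "fm_code p \<le> c0" and "e < env_count bnd c0"
    and "\<And>j. digit (env_base bnd c0) e j \<le> level bnd c0 (c0 - fm_code p)"
  shows "cov (sat_step R bnd c0) (fm_code p * env_count bnd c0 + e) \<longleftrightarrow>
    sat R (digit (env_base bnd c0) e) p"
proof -
  define M where "M = env_base bnd c0"
  define B where "B = env_count bnd c0"
  define F where "F = cov (sat_step R bnd c0)"
  note defs = M_def[symmetric] B_def[symmetric]
  have unfold: "F (c * B + e) \<longleftrightarrow>
      sat_rec R bnd c0 c e (cov_table (sat_step R bnd c0) (c * B + e))" if "e < B" for c e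
    using that unfolding F_def by (subst cov_rec, subst sat_step_def) (simp add: defs)
  have mem: "c' * B + e' \<in> set_decode (cov_table (sat_step R bnd c0) (c * B + e)) \<longleftrightarrow> F (c' * B + e')"
    if "c' < c" "e' < B" for c c' e e'
  proof -
    have "c' * B + e' < Suc c' * B" using that by simp
    also have "\<dots> \<le> c * B" using that by (intro mult_le_mono1) simp
    finally show ?thesis by (simp add: set_decode_cov_table F_def)
  qed
  have V: "tm_val (digit M e) t < Suc (M * Suc c0)" if "tm_code t \<le> c0" for e t
  proof -
    have "digit M e j \<le> M" for j by (simp add: digit_def M_def env_base_def less_imp_le)
    then have "tm_val (digit M e) t \<le> M * Suc (tm_code t)" by (rule tm_val_le)
    also have "\<dots> \<le> M * Suc c0" using that by (intro mult_le_mono2) simp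
    finally show ?thesis by simp
  qed
  have "F (fm_code p * B + e) \<longleftrightarrow> sat R (digit M e) p"
    if "fm_code p \<le> c0" "e < B" "\<And>j. digit M e j \<le> level bnd c0 (c0 - fm_code p)"
    using that
  proof (induction p arbitrary: e)
    case (Eq s t)
    have "tm_code s \<le> c0" "tm_code t \<le> c0"
      using Eq.prems(1) pair_le_code[where a = "tm_code s" and b = "tm_code t" and k = 0] by auto
    then show ?case using V
      by (auto simp: unfold Eq.prems sat_rec_def has_val_iff defs)
  next
    case (Rel s t)
    have "tm_code s \<le> c0" "tm_code t \<le> c0"
      using Rel.prems(1) pair_le_code[where a = "tm_code s" and b = "tm_code t" and k = 1] by auto
    then show ?case using V
      by (auto simp: unfold Rel.prems sat_rec_def has_val_iff defs)
  next
    case (Neg p)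
    have less: "fm_code p < fm_code (Neg p)" by (simp add: code_less)
    have "digit M e j \<le> level bnd c0 (c0 - fm_code p)" for j
      using Neg.prems(3)[of j] level_mono[of "c0 - fm_code (Neg p)" "c0 - fm_code p" bnd c0] less
      by linarith
    then have "F (fm_code p * B + e) \<longleftrightarrow> sat R (digit M e) p"
      using Neg.prems less by (intro Neg.IH) auto
    then show ?case
      using mem[OF less Neg.prems(2)] by (simp add: unfold Neg.prems sat_rec_def defs)
  next
    case (Conj p q)
    have less: "fm_code p < fm_code (Conj p q)" "fm_code q < fm_code (Conj p q)"
      by (simp_all add: code_less)
    have "digit M e j \<le> level bnd c0 (c0 - fm_code p)" "digit M e j \<le> level bnd c0 (c0 - fm_code q)" for j
      using Conj.prems(3)[of j] level_mono[of "c0 - fm_code (Conj p q)" "c0 - fm_code p" bnd c0]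
        level_mono[of "c0 - fm_code (Conj p q)" "c0 - fm_code q" bnd c0] less
      by linarith+
    then have "F (fm_code p * B + e) \<longleftrightarrow> sat R (digit M e) p" "F (fm_code q * B + e) \<longleftrightarrow> sat R (digit M e) q"
      using Conj.prems(1,2) less by (intro Conj.IH; simp)+
    then show ?case
      using mem[OF less(1) Conj.prems(2)] mem[OF less(2) Conj.prems(2)]
      by (simp add: unfold Conj.prems sat_rec_def defs)
  next
    case (Ex i p)
    have less: "fm_code p < fm_code (Ex i p)" by (simp add: code_less)
    have i: "i < Suc c0" using pair_le_code(1)[where a = i and b = "fm_code p" and k = 4] Ex.prems(1) by simp
    let ?m = "level bnd c0 (c0 - fm_code (Ex i p))" and ?m' = "level bnd c0 (c0 - fm_code p)"
    \<comment> \<open>Descending through the quantifier lowers the code by at least one, which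
      raises the level by at least one step; that step leaves room for the witness.\<close>
    have "?m + bnd c0 ?m = level bnd c0 (Suc (c0 - fm_code (Ex i p)))" by (simp add: level_def)
    also have "\<dots> \<le> ?m'" using less Ex.prems(1) by (intro level_mono) linarith
    finally have m: "?m + bnd c0 ?m \<le> ?m'" .
    have "?m' \<le> level bnd c0 c0" by (intro level_mono) simp
    then have m': "?m' < M" by (simp add: M_def env_base_def)
    then have M0: "M > 0" by simp
    \<comment> \<open>Digits beyond index \<open>c0\<close> vanish, so agreement below
      \<open>Suc c0\<close> is agreement everywhere.\<close>
    have zero: "digit M e j = 0" if "e < B" "\<not> j < Suc c0" for e j
    proof (rule digit_eq_0[OF M0])
      show "e < M ^ Suc c0" using that(1) by (simp only: B_def M_def env_count_def)
      show "Suc c0 \<le> j" using that(2) by simp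
    qed
    have F: "F (fm_code p * B + e') \<longleftrightarrow> sat R (digit M e') p"
      if "e' < B" "\<And>j. digit M e' j \<le> ?m'" for e'
      using Ex.prems(1) less that by (intro Ex.IH) auto
    have "F (fm_code (Ex i p) * B + e) \<longleftrightarrow> (\<exists>e'<B. digit M e' i \<le> ?m' \<and>
        (\<forall>j<Suc c0. j = i \<or> digit M e' j = digit M e j) \<and> F (fm_code p * B + e'))"
      using mem[OF less] by (auto simp: unfold Ex.prems sat_rec_def defs)
    also have "\<dots> \<longleftrightarrow> (\<exists>n. sat R ((digit M e)(i := n)) p)"
    proof
      assume "\<exists>e'<B. digit M e' i \<le> ?m' \<and>
        (\<forall>j<Suc c0. j = i \<or> digit M e' j = digit M e j) \<and> F (fm_code p * B + e')"
      then obtain e' where e': "e' < B" "digit M e' i \<le> ?m'"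
        "\<And>j. j < Suc c0 \<Longrightarrow> j \<noteq> i \<Longrightarrow> digit M e' j = digit M e j" "F (fm_code p * B + e')" by metis
      have eq: "digit M e' = (digit M e)(i := digit M e' i)"
      proof
        fix j
        show "digit M e' j = ((digit M e)(i := digit M e' i)) j"
          using e'(3)[of j] zero[OF e'(1), of j] zero[OF Ex.prems(2), of j] by (cases "j < Suc c0"; cases "j = i") simp_all
      qed
      have "digit M e' j \<le> ?m'" for j
        using e'(2) Ex.prems(3)[of j] m fun_cong[OF eq, of j] by (cases "j = i") simp_all
      then have "sat R (digit M e') p" using F e' by blast
      then have "sat R ((digit M e)(i := digit M e' i)) p" by (subst (asm) eq)
      then show "\<exists>n. sat R ((digit M e)(i := n)) p" by blast
    next
      assume "\<exists>n. sat R ((digit M e)(i := n)) p"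
      then obtain n where n: "n \<le> bnd (fm_code p) ?m" "sat R ((digit M e)(i := n)) p"
        using witness[of "digit M e" ?m i _ p] Ex.prems(3) by blast
      have "bnd (fm_code p) ?m \<le> bnd c0 ?m" using less Ex.prems(1) by (intro mono) linarith
      then have n': "n \<le> ?m'" using n m by linarith
      let ?f = "(digit M e)(i := n)"
      have f: "?f j \<le> ?m'" for j using n' Ex.prems(3)[of j] m by auto
      then have "?f j < M" for j using m' by (meson le_less_trans)
      then obtain e' where e': "e' < B" "\<And>j. j < Suc c0 \<Longrightarrow> digit M e' j = ?f j"
        using exists_digits[of "Suc c0" ?f M] by (auto simp: B_def M_def env_count_def)
      have "digit M e' j = ?f j" for j
        using e' zero[OF e'(1), of j] zero[OF Ex.prems(2), of j] i by (cases "j < Suc c0") auto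
      then have eq: "digit M e' = ?f" by blast
      show "\<exists>e'<B. digit M e' i \<le> ?m' \<and>
        (\<forall>j<Suc c0. j = i \<or> digit M e' j = digit M e j) \<and> F (fm_code p * B + e')"
        using e'(1) f F[OF e'(1)] n(2) n' by (intro exI[of _ e']) (auto simp: eq)
    qed
    finally show ?case by simp
  qed
  then show ?thesis using assms(3-) by (simp add: F_def B_def M_def)
qed

lemma computable_pred_tm_step:
  "computable f \<Longrightarrow> computable_pred (\<lambda>e. cov tm_step (f e))"
  unfolding tm_step_def by (rule computable_pred_cov) (intro computable_intros')+

lemma computable_pred_fm_step:
  "computable f \<Longrightarrow> computable_pred (\<lambda>e. cov fm_step (f e))"
proof (rule computable_pred_cov)
  show "computable_pred (\<lambda>e. fm_step (e 0) (e (Suc 0)))"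
    unfolding fm_step_def by (intro computable_intros' computable_pred_tm_step)
qed

lemma computable_pred_tm_vars_step:
  assumes "computable f" "computable g"
  shows "computable_pred (\<lambda>e. cov (tm_vars_step (f e)) (g e))"
proof (rule computable_pred_call2[OF _ assms])
  show "computable_pred (\<lambda>e. cov (tm_vars_step (e 0)) (e 1))"
    unfolding tm_vars_step_def by (rule computable_pred_cov) (intro computable_intros')+
qed

lemma computable_pred_free_vars_step:
  assumes "computable f" "computable g"
  shows "computable_pred (\<lambda>e. cov (free_vars_step (f e)) (g e))"
proof (rule computable_pred_call2[OF _ assms])
  show "computable_pred (\<lambda>e. cov (free_vars_step (e 0)) (e 1))"
    unfolding free_vars_step_def
    by (rule computable_pred_cov) (intro computable_intros' computable_pred_tm_vars_step)+
qed

lemma computable_digit: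
  assumes "computable f" "computable g" "computable h"
  shows "computable (\<lambda>e. digit (f e) (g e) (h e))"
  unfolding digit_def by (intro computable_intros' assms)

lemma computable_pred_has_val:
  assumes "computable f" "computable g" "computable h" "computable k"
  shows "computable_pred (\<lambda>e. has_val (f e) (g e) (h e) (k e))"
proof -
  let ?s = "\<lambda>i :: nat. if i = 0 then f else if i = 1 then g else if i = 2 then h else k"
  have "computable_pred (\<lambda>e. has_val (e 0) (e 1) (e 2) (e 3))"
    unfolding has_val_def tm_val_step_def
    by (rule computable_pred_cov) (intro computable_intros' computable_digit)+
  moreover have "computable (?s i)" for i using assms by auto
  ultimately have "computable_pred (\<lambda>e. has_val (?s 0 e) (?s 1 e) (?s 2 e) (?s 3 e))"
    unfolding computable_pred_def by (rule computable_subst)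
  then show ?thesis by simp
qed

lemma computable_level:
  assumes bnd: "computable (\<lambda>e. bnd (e 0) (e 1))" and "computable f" "computable g"
  shows "computable (\<lambda>e. level bnd (f e) (g e))"
proof (rule computable_call2[OF _ assms(2,3)])
  show "computable (\<lambda>e. level bnd (e 0) (e 1))"
    unfolding level_def
    by (intro computable_rec_nat computable_intros computable_call2[OF bnd])
qed

lemma computable_pred_sat_step:
  assumes R: "computable_pred (\<lambda>e. (e 0, e 1) \<in> R)" and bnd: "computable (\<lambda>e. bnd (e 0) (e 1))"
    and "computable f" "computable g"
  shows "computable_pred (\<lambda>e. cov (sat_step R bnd (f e)) (g e))"
proof (rule computable_pred_call2[OF _ assms(3,4)])
  have R': "computable_pred (\<lambda>e. (f e, g e) \<in> R)" if "computable f" "computable g" for f g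
    using computable_pred_call2[OF R that] .
  show "computable_pred (\<lambda>e. cov (sat_step R bnd (e 0)) (e 1))"
    unfolding sat_step_def sat_rec_def env_count_def env_base_def
    by (rule computable_pred_cov)
      (intro computable_intros' computable_digit computable_pred_has_val computable_level[OF bnd] R')+
qed

theorem decidable_if_bounded_witnesses:
  assumes R: "computable_pred (\<lambda>e. (e 0, e 1) \<in> R)" and bnd: "computable (\<lambda>e. bnd (e 0) (e 1))"
    and mono: "\<And>c c' m. c \<le> c' \<Longrightarrow> bnd c m \<le> bnd c' m"
    and witness: "\<And>p i e m n. (\<And>j. e j \<le> m) \<Longrightarrow> sat R (e(i := n)) p \<Longrightarrow>
      \<exists>n\<le>bnd (fm_code p) m. sat R (e(i := n)) p"
  shows "decidable (fm_code ` true_sentences R)"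
proof -
  let ?P = "\<lambda>c. cov fm_step c \<and> (\<forall>i<Suc c. \<not> cov (free_vars_step i) c) \<and>
    cov (sat_step R bnd c) (c * env_count bnd c)"
  have digit0: "digit M 0 = (\<lambda>_. 0)" for M by (auto simp: digit_def)
  have iff: "c \<in> fm_code ` true_sentences R \<longleftrightarrow> ?P c" for c
  proof (cases "\<exists>p. fm_code p = c")
    case True
    then obtain p where p: "c = fm_code p" by blast
    have "c \<in> fm_code ` true_sentences R \<longleftrightarrow> p \<in> true_sentences R"
      by (auto simp: p fm_code_eq_iff)
    also have "\<dots> \<longleftrightarrow> free_vars p = {} \<and> sat R (\<lambda>_. 0) p" by (rule sentence_true_iff)
    also have "free_vars p = {} \<longleftrightarrow> (\<forall>i<Suc c. \<not> cov (free_vars_step i) c)"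
      unfolding p cov_free_vars_step using free_vars_le_code less_Suc_eq_le by blast
    also have "sat R (\<lambda>_. 0) p \<longleftrightarrow> cov (sat_step R bnd c) (c * env_count bnd c)"
    proof -
      \<comment> \<open>The number \<open>0\<close> codes the all-zero assignment, which meets the
        initial level \<open>0\<close>.\<close>
      have "cov (sat_step R bnd c) (fm_code p * env_count bnd c + 0) \<longleftrightarrow>
          sat R (digit (env_base bnd c) 0) p"
        by (rule cov_sat_step[OF mono witness])
          (auto simp: p digit0 env_count_def env_base_def)
      then show ?thesis by (simp add: p digit0)
    qed
    finally show ?thesis by (simp add: p cov_fm_step_code)
  next
    case False
    then show ?thesis using cov_fm_step_imp by blast
  qed
  have "decidable {c. ?P c}"
    unfolding env_count_def env_base_def
    by (intro decidable_if_computable_pred computable_intros' computable_pred_fm_step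
        computable_pred_free_vars_step computable_pred_sat_step[OF R bnd] computable_level[OF bnd])
  moreover have "fm_code ` true_sentences R = {c. ?P c}"
    by (rule set_eqI, subst iff) (rule mem_Collect_eq[symmetric])
  ultimately show ?thesis by simp
qed

section \<open>Finite index\<close>

text \<open>The equation says that \<open>d\<close> and \<open>1 / d\<close> are conjugate, the
  roots of \<open>x^2 - t x + 1\<close>; so \<open>t\<close> is the trace of the unit
  \<open>1 / d\<close>, whose norm is \<open>1\<close>.\<close>

locale quadratic_unit =
  fixes t :: int and d :: real
  assumes d_pos: "0 < d" and d_less: "d < 1" and d_eq: "d * d + 1 = t * d" and d_irrat: "d \<notin> \<rat>"
begin

lemma inverse_d: "1 / d = t - d"
  using d_pos d_eq by (simp add: field_simps)

lemma t_pos: "t > 0"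
proof -
  have "real_of_int t * d > 0" using d_eq d_pos by (metis add_pos_pos mult_pos_pos zero_less_one)
  then show ?thesis using d_pos by (simp add: zero_less_mult_iff)
qed

text \<open>With \<open>u\<^sub>0 = 1\<close>, \<open>u\<^sub>1 = t\<close> and \<open>u\<^sub>k\<^sub>+\<^sub>2 = t u\<^sub>k\<^sub>+\<^sub>1 - u\<^sub>k\<close>, a digit string \<open>(a\<^sub>k)\<close> is
  represented by the pair of \<open>\<Sum> a\<^sub>k u\<^sub>k\<close> and \<open>\<Sum> a\<^sub>k u\<^sub>k\<^sub>-\<^sub>1\<close>, where \<open>u\<^sub>-\<^sub>1 = 0\<close>. The function \<open>child\<close>
  appends a least significant digit.\<close>

definition child :: "int \<times> int \<Rightarrow> int \<Rightarrow> int \<times> int" where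
  "child v a = (t * fst v - snd v + a, fst v)"

inductive reach :: "nat \<Rightarrow> int \<times> int \<Rightarrow> bool" where
  zero: "reach 0 (0, 0)"
| child: "reach n v \<Longrightarrow> 0 \<le> a \<Longrightarrow> a < t \<Longrightarrow> reach (Suc n) (child v a)"

text \<open>The conjugate of \<open>x / d - y\<close> in \<open>\<rat>(d)\<close>.\<close>

definition cj :: "int \<times> int \<Rightarrow> real" where
  "cj v = d * fst v - snd v"

lemma cj_child: "cj (child v a) = d * (cj v + a)"
proof -
  have "(d * d + 1) * fst v = (t * d) * fst v" by (simp only: d_eq)
  then show ?thesis by (simp add: cj_def child_def algebra_simps)
qed

text \<open>The sum of \<open>t * d^k\<close> over \<open>k >= 1\<close>, that is, the fixed point
  of \<open>w -> d * (w + t)\<close>; as a bound on \<open>cj\<close> it therefore survives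
  appending a digit.\<close>

definition window :: real where
  "window = t * d / (1 - d)"

lemma window_eq: "d * (window + t) = window"
  using d_less by (simp add: window_def field_simps)

lemma window_nonneg: "window \<ge> 0"
  using d_pos d_less t_pos by (simp add: window_def)

text \<open>All bounds are proved together because they need each other: \<open>cj v >= 0\<close>
  means \<open>snd v <= d * fst v\<close>, so the new first component is at least
  \<open>(t - d) * fst v = fst v / d >= 0\<close>, while \<open>snd v >= 0\<close> limits its
  growth.\<close>

lemma reach_bounds:
  assumes "reach n v"
  shows "0 \<le> fst v \<and> 0 \<le> snd v \<and> 0 \<le> cj v \<and> cj v \<le> window \<and> fst v \<le> (2 * t) ^ n"
  using assms
proof (induction n v rule: reach.induct)
  case zero
  then show ?case by (simp add: cj_def window_nonneg)
next
  case (child n v a)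
  have "0 \<le> (1 / d) * fst v" using child d_pos by simp
  also have "\<dots> = (t - d) * fst v" by (simp add: inverse_d)
  also have "\<dots> \<le> t * fst v - snd v"
    using child by (simp add: cj_def algebra_simps)
  finally have "0 \<le> t * fst v - snd v + a" using \<open>0 \<le> a\<close> by linarith
  moreover have "d * (cj v + a) \<le> d * (window + t)"
    using child d_pos by (intro mult_left_mono) auto
  moreover have "t * fst v - snd v + a \<le> (2 * t) ^ Suc n"
  proof -
    have "t * fst v + t * 1 \<le> t * (2 * t) ^ n + t * (2 * t) ^ n"
      using child t_pos one_le_power[of "2 * t" n] by (intro add_mono mult_left_mono) auto
    moreover have "(2 * t) ^ Suc n = t * (2 * t) ^ n + t * (2 * t) ^ n" by simp
    ultimately show ?thesis using child by linarith
  qed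
  moreover have "cj (child v a) = d * (cj v + a)" by (rule cj_child)
  ultimately show ?case
    using child d_pos by (simp add: window_eq) (simp add: child_def)
qed

lemma reach_Suc: "reach n v \<Longrightarrow> reach (Suc n) v"
proof (induction n v rule: reach.induct)
  case zero
  show ?case using reach.child[OF reach.zero, of 0] t_pos by (simp add: child_def)
next
  case (child n v a)
  then show ?case by (intro reach.child)
qed

lemma reach_mono: "reach n v \<Longrightarrow> n \<le> m \<Longrightarrow> reach m v"
  by (induction m) (auto simp: le_Suc_eq reach_Suc)

text \<open>The string without its last digit represents \<open>\<lfloor>d n\<rfloor>\<close>.\<close>

lemma exists_reach: "\<exists>y. reach n (int n, y)"
proof -
  have "reach n (int n, \<lfloor>d * n\<rfloor>)"
  proof (induction n rule: less_induct)
    case (less n)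
    show ?case
    proof (cases "n = 0")
      case True
      then show ?thesis by (simp add: reach.zero)
    next
      case False
      define m where "m = nat \<lfloor>d * n\<rfloor>"
      have m: "int m = \<lfloor>d * n\<rfloor>" using d_pos by (simp add: m_def)
      have m1: "real m \<le> d * n" "d * n < real m + 1" using m by linarith+
      have "d * n < n" using d_less False by simp
      then have "m < n" using m1 by linarith
      \<comment> \<open>The recurrence forces this digit. It is admissible because \<open>n\<close>
        lies between \<open>m / d\<close> and \<open>(m + 1) / d\<close>, where
        \<open>1 / d = t - d\<close>.\<close>
      define a where "a = int n - (t * m - \<lfloor>d * m\<rfloor>)"
      have m2: "(t - d) * m \<le> n" "n < (t - d) * (m + 1)"
        using m1 d_pos by (simp_all add: inverse_d[symmetric] field_simps)
      have "real_of_int \<lfloor>d * m\<rfloor> \<le> d * m" "d * m < \<lfloor>d * m\<rfloor> + 1" by linarith+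
      moreover have "real_of_int a = n - t * m + \<lfloor>d * m\<rfloor>" by (simp add: a_def)
      moreover have "t * m - d * m \<le> n" "n < t * m - d * m + t - d"
        using m2 by (simp_all add: algebra_simps)
      ultimately have "real_of_int a > - 1" "real_of_int a < t"
        using d_pos by linarith+
      then have "0 \<le> a" "a < t" by linarith+
      then have "reach (Suc m) (child (int m, \<lfloor>d * m\<rfloor>) a)"
        using less.IH[OF \<open>m < n\<close>] by (intro reach.child) auto
      moreover have "child (int m, \<lfloor>d * m\<rfloor>) a = (int n, \<lfloor>d * n\<rfloor>)"
        by (simp add: child_def a_def m)
      ultimately show ?thesis using reach_mono[of "Suc m" _ n] \<open>m < n\<close> by simp
    qed
  qed
  then show ?thesis ..
qed

section \<open>Congruences of finite index and their closure under the logical operations\<close>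

definition configs :: "(nat \<Rightarrow> int \<times> int) set" where
  "configs = {s. \<forall>i. \<exists>n. reach n (s i)}"

definition letters :: "(nat \<Rightarrow> int) set" where
  "letters = {a. \<forall>i. 0 \<le> a i \<and> a i < t}"

definition next_config :: "(nat \<Rightarrow> int \<times> int) \<Rightarrow> (nat \<Rightarrow> int) \<Rightarrow> nat \<Rightarrow> int \<times> int" where
  "next_config s a = (\<lambda>i. child (s i) (a i))"

definition env_of :: "(nat \<Rightarrow> int \<times> int) \<Rightarrow> nat \<Rightarrow> nat" where
  "env_of s = (\<lambda>i. nat (fst (s i)))"

lemma next_config_upd: "next_config (s(i := v)) (a(i := b)) = (next_config s a)(i := child v b)"
  by (auto simp: next_config_def)

lemma env_of_upd: "env_of (s(i := v)) = (env_of s)(i := nat (fst v))"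
  by (auto simp: env_of_def)

lemma configs_upd: "s \<in> configs \<Longrightarrow> reach n v \<Longrightarrow> s(i := v) \<in> configs"
  by (auto simp: configs_def)

lemma letters_upd: "a \<in> letters \<Longrightarrow> 0 \<le> b \<Longrightarrow> b < t \<Longrightarrow> a(i := b) \<in> letters"
  by (auto simp: letters_def)

text \<open>A Myhill-Nerode congruence, given by its class map.\<close>

definition index_map ::
  "((nat \<Rightarrow> int \<times> int) \<Rightarrow> nat) \<Rightarrow> nat \<Rightarrow> ((nat \<Rightarrow> nat) \<Rightarrow> bool) \<Rightarrow> bool" where
  "index_map \<sigma> N P \<longleftrightarrow> \<sigma> ` configs \<subseteq> {..<N} \<and>
     (\<forall>s\<in>configs. \<forall>s'\<in>configs. \<sigma> s = \<sigma> s' \<longrightarrow>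
        (P (env_of s) \<longleftrightarrow> P (env_of s')) \<and>
        (\<forall>a\<in>letters. \<sigma> (next_config s a) = \<sigma> (next_config s' a)))"

definition has_index :: "nat \<Rightarrow> ((nat \<Rightarrow> nat) \<Rightarrow> bool) \<Rightarrow> bool" where
  "has_index N P \<longleftrightarrow> (\<exists>\<sigma>. index_map \<sigma> N P)"

lemma index_mapD:
  assumes "index_map \<sigma> N P"
  shows "\<sigma> ` configs \<subseteq> {..<N}"
    "s \<in> configs \<Longrightarrow> s' \<in> configs \<Longrightarrow> \<sigma> s = \<sigma> s' \<Longrightarrow> P (env_of s) \<longleftrightarrow> P (env_of s')"
    "s \<in> configs \<Longrightarrow> s' \<in> configs \<Longrightarrow> \<sigma> s = \<sigma> s' \<Longrightarrow> a \<in> letters \<Longrightarrow>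
      \<sigma> (next_config s a) = \<sigma> (next_config s' a)"
  using assms unfolding index_map_def by blast+

text \<open>Classes may be labelled by any finite set, which is then renumbered. One implication for
  \<open>P\<close> suffices because the hypotheses are symmetric in \<open>s\<close> and
  \<open>s'\<close>.\<close>

lemma has_indexI:
  assumes "finite S" "card S \<le> N" "\<And>s. s \<in> configs \<Longrightarrow> f s \<in> S"
    and "\<And>s s'. s \<in> configs \<Longrightarrow> s' \<in> configs \<Longrightarrow> f s = f s' \<Longrightarrow> P (env_of s) \<Longrightarrow> P (env_of s')"
    and "\<And>s s' a. s \<in> configs \<Longrightarrow> s' \<in> configs \<Longrightarrow> f s = f s' \<Longrightarrow> a \<in> letters \<Longrightarrow>
      f (next_config s a) = f (next_config s' a)"
  shows "has_index N P"
proof -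
  obtain h where h: "bij_betw h S {..<card S}"
    using ex_bij_betw_finite_nat[OF assms(1)] by (auto simp: atLeast0LessThan)
  have inj: "h (f s) = h (f s') \<longleftrightarrow> f s = f s'" if "s \<in> configs" "s' \<in> configs" for s s'
    using assms(3) that by (intro inj_on_eq_iff[OF bij_betw_imp_inj_on[OF h]])
  show ?thesis unfolding has_index_def index_map_def
  proof (intro exI[of _ "\<lambda>s. h (f s)"] conjI ballI impI)
    show "(\<lambda>s. h (f s)) ` configs \<subseteq> {..<N}"
    proof
      fix x assume "x \<in> (\<lambda>s. h (f s)) ` configs"
      then have "x \<in> {..<card S}" using assms(3) bij_betwE[OF h] by blast
      then show "x \<in> {..<N}" using assms(2) by simp
    qed
  next
    fix s s' assume s: "s \<in> configs" "s' \<in> configs" "h (f s) = h (f s')"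
    have eq: "f s = f s'" using inj[OF s(1,2)] s(3) by simp
    show "P (env_of s) \<longleftrightarrow> P (env_of s')"
      using assms(4)[OF s(1,2) eq] assms(4)[OF s(2,1) eq[symmetric]] by (rule iffI)
  next
    fix s s' a assume s: "s \<in> configs" "s' \<in> configs" "h (f s) = h (f s')" and "a \<in> letters"
    have eq: "f s = f s'" using inj[OF s(1,2)] s(3) by simp
    show "h (f (next_config s a)) = h (f (next_config s' a))"
      using assms(5)[OF s(1,2) eq \<open>a \<in> letters\<close>] by (rule arg_cong)
  qed
qed

lemma has_index_mono: "has_index N P \<Longrightarrow> N \<le> N' \<Longrightarrow> has_index N' P"
  unfolding has_index_def index_map_def by (meson lessThan_subset_iff order_trans)

lemma has_index_Not: "has_index N P \<Longrightarrow> has_index N (\<lambda>e. \<not> P e)"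
  unfolding has_index_def index_map_def by simp

lemma has_index_Conj:
  assumes "has_index M P" "has_index N Q"
  shows "has_index (M * N) (\<lambda>e. P e \<and> Q e)"
proof -
  obtain \<sigma> where "index_map \<sigma> M P"
    using assms(1) unfolding has_index_def ..
  note \<sigma> = index_mapD[OF this]
  obtain \<tau> where "index_map \<tau> N Q"
    using assms(2) unfolding has_index_def ..
  note \<tau> = index_mapD[OF this]
  show ?thesis
  proof (rule has_indexI[where f = "\<lambda>s. (\<sigma> s, \<tau> s)" and S = "{..<M} \<times> {..<N}"])
    fix s s' :: "nat \<Rightarrow> int \<times> int" and a
    assume s: "s \<in> configs" "s' \<in> configs" and "(\<sigma> s, \<tau> s) = (\<sigma> s', \<tau> s')"
    then have eq: "\<sigma> s = \<sigma> s'" "\<tau> s = \<tau> s'" by simp_all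
    show "P (env_of s') \<and> Q (env_of s')" if "P (env_of s) \<and> Q (env_of s)"
      using that \<sigma>(2)[OF s eq(1)] \<tau>(2)[OF s eq(2)] by simp
    show "(\<sigma> (next_config s a), \<tau> (next_config s a)) = (\<sigma> (next_config s' a), \<tau> (next_config s' a))"
      if "a \<in> letters"
      using \<sigma>(3)[OF s eq(1) that] \<tau>(3)[OF s eq(2) that] by simp
  next
    show "(\<sigma> s, \<tau> s) \<in> {..<M} \<times> {..<N}" if "s \<in> configs" for s
      using that \<sigma>(1) \<tau>(1) by blast
  qed (simp_all add: card_cartesian_product)
qed

text \<open>The empty string is its own parent with digit \<open>0\<close>, which is why truncated
  subtraction is right for \<open>n = 0\<close>.\<close>

lemma reach_parent:
  assumes "reach n v"
  obtains u b where "reach (n - 1) u" "0 \<le> b" "b < t" "v = child u b"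
  using assms
proof cases
  case zero
  then show thesis using that[of "(0, 0)" 0] t_pos by (simp add: child_def reach.zero)
next
  case (child m u b)
  then show thesis using that[of u b] by simp
qed

text \<open>Subset construction: the new class of \<open>s\<close> is the set of classes obtained by
  varying coordinate \<open>i\<close> over all strings. These may be longer than the other strings,
  since leading zeros leave a pair unchanged. Each has a last digit, so the sets after one more
  digit are determined by the sets before it.\<close>

lemma has_index_Ex:
  assumes "has_index N P"
  shows "has_index (2 ^ N) (\<lambda>e. \<exists>n. P (e(i := n)))"
proof -
  obtain \<sigma> where "index_map \<sigma> N P"
    using assms(1) unfolding has_index_def ..
  note \<sigma> = index_mapD[OF this]
  let ?f = "\<lambda>s. {\<sigma> (s(i := v)) |v n. reach n v}"
  show ?thesis
  proof (rule has_indexI[where f = ?f and S = "Pow {..<N}"])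
    fix s assume "s \<in> configs"
    then show "?f s \<in> Pow {..<N}" using \<sigma>(1) configs_upd by blast
  next
    fix s s' assume s: "s \<in> configs" "s' \<in> configs" "?f s = ?f s'"
    assume "\<exists>n. P ((env_of s)(i := n))"
    then obtain n where n: "P ((env_of s)(i := n))" ..
    obtain y where y: "reach n (int n, y)" using exists_reach by blast
    then have "\<sigma> (s(i := (int n, y))) \<in> ?f s'" unfolding s(3)[symmetric] by blast
    then obtain m v where v: "reach m v" "\<sigma> (s(i := (int n, y))) = \<sigma> (s'(i := v))" by blast
    have "P (env_of (s(i := (int n, y))))" using n by (simp add: env_of_upd)
    then have "P (env_of (s'(i := v)))"
      using \<sigma>(2)[OF configs_upd[OF s(1) y] configs_upd[OF s(2) v(1)] v(2)] by simp
    then show "\<exists>n. P ((env_of s')(i := n))" by (auto simp: env_of_upd)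
  next
    have sub: "?f (next_config s a) \<subseteq> ?f (next_config s' a)"
      if s: "s \<in> configs" "s' \<in> configs" "?f s = ?f s'" and a: "a \<in> letters" for s s' a
    proof
      fix x assume "x \<in> ?f (next_config s a)"
      then obtain n v where v: "reach n v" "x = \<sigma> ((next_config s a)(i := v))" by blast
      obtain u b where u: "reach (n - 1) u" "0 \<le> b" "b < t" "v = child u b"
        using reach_parent[OF v(1)] .
      then have "\<sigma> (s(i := u)) \<in> ?f s'" unfolding s(3)[symmetric] by blast
      then obtain m u' where u': "reach m u'" "\<sigma> (s(i := u)) = \<sigma> (s'(i := u'))" by blast
      have "\<sigma> (next_config (s(i := u)) (a(i := b))) = \<sigma> (next_config (s'(i := u')) (a(i := b)))"
        by (rule \<sigma>(3)[OF configs_upd[OF s(1) u(1)] configs_upd[OF s(2) u'(1)] u'(2) letters_upd[OF a u(2,3)]])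
      then have "x = \<sigma> ((next_config s' a)(i := child u' b))"
        using v(2) u(4) by (simp add: next_config_upd)
      moreover have "reach (Suc m) (child u' b)" using u'(1) u by (intro reach.child)
      ultimately show "x \<in> ?f (next_config s' a)" by blast
    qed
    fix s s' a assume "s \<in> configs" "s' \<in> configs" "?f s = ?f s'" "a \<in> letters"
    then show "?f (next_config s a) = ?f (next_config s' a)"
      using sub[of s s' a] sub[of s' s a] by (intro equalityI) simp_all
  qed (auto simp: card_Pow)
qed

text \<open>Pumping: above the most significant digits of the other variables, the set of classes
  reachable with \<open>k\<close> further digits of the quantified variable is constant from \<open>k = N\<close> on.\<close>

lemma bounded_witness:
  assumes "has_index N P" and e: "\<And>j. e j \<le> m" and "P (e(i := n))"
  shows "\<exists>n\<le>(2 * nat t) ^ (N + m). P (e(i := n))"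
proof -
  obtain \<sigma> where "index_map \<sigma> N P"
    using assms(1) unfolding has_index_def ..
  note \<sigma> = index_mapD[OF this]
  let ?z = "\<lambda>_ :: nat. (0 :: int, 0 :: int)"
  let ?a = "\<lambda>_ :: nat. 0 :: int"
  have z: "?z \<in> configs" using reach.zero by (auto simp: configs_def)
  have a: "?a \<in> letters" using t_pos by (simp add: letters_def)
  have za: "next_config ?z ?a = ?z" by (simp add: next_config_def child_def)
  \<comment> \<open>The classes that arise from \<open>k\<close> digits in coordinate
    \<open>i\<close> while all other coordinates are zero.\<close>
  define A where "A k = {\<sigma> (?z(i := v)) |v. reach k v}" for k
  have A_sub: "A k \<subseteq> {..<N}" for k
    using \<sigma>(1) configs_upd[OF z] unfolding A_def by blast
  have A_Suc: "A k \<subseteq> A (Suc k)" for k using reach_Suc unfolding A_def by blast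
  have A_next: "A (Suc j) \<subseteq> A (Suc k)" if "A j \<subseteq> A k" for j k
  proof
    fix x assume "x \<in> A (Suc j)"
    then obtain v where v: "reach (Suc j) v" "x = \<sigma> (?z(i := v))" by (auto simp: A_def)
    obtain u b where u: "reach j u" "0 \<le> b" "b < t" "v = child u b"
      using reach_parent[OF v(1)] by auto
    then have "\<sigma> (?z(i := u)) \<in> A k" using that unfolding A_def by blast
    then obtain u' where u': "reach k u'" "\<sigma> (?z(i := u)) = \<sigma> (?z(i := u'))"
      unfolding A_def by blast
    have "\<sigma> (next_config (?z(i := u)) (?a(i := b))) = \<sigma> (next_config (?z(i := u')) (?a(i := b)))"
      by (rule \<sigma>(3)[OF configs_upd[OF z u(1)] configs_upd[OF z u'(1)] u'(2) letters_upd[OF a u(2,3)]])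
    then have "x = \<sigma> (?z(i := child u' b))"
      using v(2) u(4) by (simp only: next_config_upd za)
    moreover have "reach (Suc k) (child u' b)" using u'(1) u by (intro reach.child)
    ultimately show "x \<in> A (Suc k)" unfolding A_def by blast
  qed
  \<comment> \<open>By \<open>A_next\<close>, \<open>A (Suc k)\<close> depends only on
    \<open>A k\<close>. So this increasing chain is constant once it pauses, and inside a set of
    \<open>N\<close> elements it pauses by stage \<open>N\<close>.\<close>
  have "A N = (\<Union>k. A k)"
  proof -
    have "mono A" using A_Suc by (intro mono_iff_le_Suc[THEN iffD2]) simp
    moreover have "finite (range A)"
      by (rule finite_subset[of _ "Pow {..<N}"]) (use A_sub in auto)
    moreover have "\<forall>k. A k = A (Suc k) \<longrightarrow> A (Suc k) = A (Suc (Suc k))"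
      by (intro allI impI equalityI A_next) simp_all
    ultimately have "\<exists>N. (\<forall>n\<le>N. \<forall>m\<le>N. m < n \<longrightarrow> A m \<subset> A n) \<and> (\<forall>n\<ge>N. A N = A n)"
      by (intro finite_mono_remains_stable_implies_strict_prefix)
    then have "A (card {..<N}) = (\<Union>k. A k)"
      using A_sub by (intro finite_mono_strict_prefix_implies_finite_fixpoint) auto
    then show ?thesis by simp
  qed
  \<comment> \<open>Strip \<open>m\<close> digits from every coordinate. The others become zero, the
    rest of \<open>v\<close> can be replaced by \<open>N\<close> digits of the same class, and
    appending the stripped digits again preserves equality of classes.\<close>
  have pump: "\<exists>v'. reach (N + m) v' \<and> \<sigma> (s(i := v)) = \<sigma> (s(i := v'))"
    if "\<And>j. reach m (s j)" "reach k v" for m k s v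
    using that
  proof (induction m arbitrary: s k v)
    case 0
    have s: "s = ?z"
    proof
      fix j
      show "s j = (0, 0)" using 0(1)[of j] by cases
    qed
    have "\<sigma> (?z(i := v)) \<in> (\<Union>k. A k)" using 0(2) unfolding A_def by blast
    then have "\<sigma> (?z(i := v)) \<in> A N" using \<open>A N = (\<Union>k. A k)\<close> by simp
    then obtain v' where "reach N v'" "\<sigma> (?z(i := v)) = \<sigma> (?z(i := v'))"
      unfolding A_def by blast
    then have "reach (N + 0) v' \<and> \<sigma> (?z(i := v)) = \<sigma> (?z(i := v'))" unfolding add_0_right ..
    then show ?case unfolding s by (rule exI)
  next
    case (Suc m)
    have "\<exists>u b. reach m u \<and> 0 \<le> b \<and> b < t \<and> s j = child u b" for j
    proof -
      obtain u b where "reach (Suc m - 1) u" "0 \<le> b" "b < t" "s j = child u b"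
        using reach_parent[OF Suc.prems(1)[of j]] .
      then show ?thesis unfolding diff_Suc_1 by (intro exI[of _ u] exI[of _ b] conjI)
    qed
    then have "\<exists>s0. \<forall>j. \<exists>b. reach m (s0 j) \<and> 0 \<le> b \<and> b < t \<and> s j = child (s0 j) b"
      by (intro choice allI)
    then obtain s0 where
      "\<And>j. \<exists>b. reach m (s0 j) \<and> 0 \<le> b \<and> b < t \<and> s j = child (s0 j) b" by blast
    then have "\<exists>c. \<forall>j. reach m (s0 j) \<and> 0 \<le> c j \<and> c j < t \<and> s j = child (s0 j) (c j)"
      by (intro choice allI)
    then obtain c where s0: "\<And>j. reach m (s0 j)" "\<And>j. 0 \<le> c j" "\<And>j. c j < t"
      "\<And>j. s j = child (s0 j) (c j)" by blast
    have s: "s = next_config s0 c"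
      unfolding next_config_def by (rule ext) (rule s0(4))
    have c: "c \<in> letters" unfolding letters_def using s0(2,3) by simp
    have s0c: "s0 \<in> configs" unfolding configs_def using s0(1) by blast
    obtain u b where u: "reach (k - 1) u" "0 \<le> b" "b < t" "v = child u b"
      using reach_parent[OF Suc.prems(2)] .
    obtain u' where u': "reach (N + m) u'" "\<sigma> (s0(i := u)) = \<sigma> (s0(i := u'))"
      using Suc.IH[of s0, OF s0(1) u(1)] by blast
    have "\<sigma> (next_config (s0(i := u)) (c(i := b))) = \<sigma> (next_config (s0(i := u')) (c(i := b)))"
      by (rule \<sigma>(3)[OF configs_upd[OF s0c u(1)] configs_upd[OF s0c u'(1)] u'(2) letters_upd[OF c u(2,3)]])
    then have "\<sigma> (s(i := v)) = \<sigma> (s(i := child u' b))"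
      by (simp only: next_config_upd s u(4))
    moreover have "reach (N + Suc m) (child u' b)" using reach.child[OF u'(1) u(2,3)] by simp
    ultimately show ?case by (intro exI[of _ "child u' b"] conjI)
  qed
  have "\<exists>v. reach m v \<and> fst v = int (e j)" for j
  proof -
    obtain y where "reach (e j) (int (e j), y)" using exists_reach by blast
    from reach_mono[OF this e[of j]] show ?thesis by (intro exI[of _ "(int (e j), y)"]) simp
  qed
  then have "\<exists>s. \<forall>j. reach m (s j) \<and> fst (s j) = int (e j)" by (intro choice allI)
  then obtain s where s: "\<And>j. reach m (s j)" "\<And>j. fst (s j) = int (e j)" by blast
  have es: "env_of s = e" using s(2) by (auto simp: env_of_def)
  have sc: "s \<in> configs" unfolding configs_def using s(1) by blast
  obtain y where y: "reach n (int n, y)" using exists_reach by blast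
  obtain v where v: "reach (N + m) v" "\<sigma> (s(i := (int n, y))) = \<sigma> (s(i := v))"
    using pump[of m s, OF s(1) y] by blast
  have "P (env_of (s(i := (int n, y))))" using assms(3) by (simp add: env_of_upd es)
  then have "P (env_of (s(i := v)))"
    using \<sigma>(2)[OF configs_upd[OF sc y] configs_upd[OF sc v(1)] v(2)] by simp
  then have "P (e(i := nat (fst v)))" by (simp add: env_of_upd es)
  moreover have "nat (fst v) \<le> (2 * nat t) ^ (N + m)"
  proof -
    have "nat (fst v) \<le> nat ((2 * t) ^ (N + m))"
      using reach_bounds[OF v(1)] by (intro nat_mono) (elim conjE)
    also have "\<dots> = (2 * nat t) ^ (N + m)"
      using t_pos by (simp add: nat_power_eq nat_mult_distrib)
    finally show ?thesis .
  qed
  ultimately show ?thesis by (intro exI[of _ "nat (fst v)"] conjI)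
qed

end

section \<open>The congruence of the floor relation between terms\<close>

primrec tm_int :: "(nat \<Rightarrow> int) \<Rightarrow> tm \<Rightarrow> int" where
  "tm_int f (Var i) = f i"
| "tm_int f (Plus u r) = tm_int f u + tm_int f r"

primrec leaves :: "tm \<Rightarrow> nat" where
  "leaves (Var i) = 1"
| "leaves (Plus u r) = leaves u + leaves r"

lemma card_box: "K \<ge> 0 \<Longrightarrow> card ({- K..K} \<times> {- K..K :: int}) = nat (2 * K + 1) ^ 2"
  by (simp add: card_cartesian_product power2_eq_square) 

context quadratic_unit
begin

text \<open>Representing a sum by the sum of the pairs amounts to a string with larger digits, of
  size at most \<open>t * leaves u\<close>. No carries are needed.\<close>

definition tm_pair :: "(nat \<Rightarrow> int \<times> int) \<Rightarrow> tm \<Rightarrow> int \<times> int" where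
  "tm_pair s u = (tm_int (\<lambda>i. fst (s i)) u, tm_int (\<lambda>i. snd (s i)) u)"

lemma tm_pair_next: "tm_pair (next_config s a) u = child (tm_pair s u) (tm_int a u)"
  by (induction u) (auto simp: tm_pair_def next_config_def child_def algebra_simps)

lemma tm_int_letters:
  assumes "a \<in> letters"
  shows "0 \<le> tm_int a u \<and> tm_int a u \<le> t * leaves u"
proof (induction u)
  case (Var i)
  then show ?case using assms by (simp add: letters_def less_imp_le)
next
  case (Plus u r)
  then show ?case by (simp add: distrib_left)
qed

lemma tm_pair_bounds:
  assumes "s \<in> configs"
  shows "0 \<le> fst (tm_pair s u) \<and> 0 \<le> cj (tm_pair s u) \<and> cj (tm_pair s u) \<le> window * leaves u"
proof (induction u)
  case (Var i)
  obtain n where "reach n (s i)" using assms by (auto simp: configs_def)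
  from reach_bounds[OF this] show ?case by (simp add: tm_pair_def)
next
  case (Plus u r)
  have "cj (tm_pair s (Plus u r)) = cj (tm_pair s u) + cj (tm_pair s r)"
    by (simp add: tm_pair_def cj_def algebra_simps)
  then show ?case using Plus by (simp add: distrib_left) (simp add: tm_pair_def)
qed

lemma tm_val_env_of:
  assumes "s \<in> configs"
  shows "int (tm_val (env_of s) u) = fst (tm_pair s u)"
proof (induction u)
  case (Var i)
  then show ?case
    using tm_pair_bounds[OF assms, of "Var i"] by (simp add: env_of_def tm_pair_def)
next
  case (Plus u r)
  then show ?case by (simp add: tm_pair_def)
qed

lemma real_tm_val: "s \<in> configs \<Longrightarrow> real (tm_val (env_of s) u) = real_of_int (fst (tm_pair s u))"
  by (simp flip: tm_val_env_of)

text \<open>The relation \<open>y = \<lfloor>x \<alpha> + \<beta>\<rfloor>\<close> for \<open>\<alpha> = (a + b d) / q\<close> and \<open>\<beta> = (a0 + b0 d) / q\<close>.\<close>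

definition floor_rel :: "int \<Rightarrow> int \<Rightarrow> int \<Rightarrow> int \<Rightarrow> int \<Rightarrow> nat \<Rightarrow> nat \<Rightarrow> bool" where
  "floor_rel a b a0 b0 q x y \<longleftrightarrow>
     0 \<le> (a + b * d) * x + (a0 + b0 * d) - q * y \<and> (a + b * d) * x + (a0 + b0 * d) - q * y < q"

text \<open>The second component is the same form at the previous terms of the recurrence: \<open>X\<close> is
  preceded by \<open>(snd X, t * snd X - fst X)\<close>.\<close>

definition lin :: "int \<Rightarrow> int \<Rightarrow> int \<Rightarrow> int \<times> int \<Rightarrow> int \<times> int \<Rightarrow> int \<times> int" where
  "lin a b q X Y = (a * fst X + b * snd X - q * fst Y,
     a * snd X + b * (t * snd X - fst X) - q * snd Y)"

text \<open>The next pair depends only on the current pair and the new digits. The weight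
  \<open>- b\<close> of \<open>A\<close> in the second component is \<open>b\<close> times the
  backward term \<open>u\<^sub>-\<^sub>2 = - 1\<close>.\<close>

lemma lin_child:
  "lin a b q (child X A) (child Y A') =
     (t * fst (lin a b q X Y) - snd (lin a b q X Y) + (a * A - q * A'), fst (lin a b q X Y) - b * A)"
  by (simp add: lin_def child_def algebra_simps)

text \<open>Moving one index back in the recurrence multiplies the conjugate by
  \<open>1 / d\<close>. Hence the conjugate of the form is bounded whenever those of
  \<open>X\<close> and \<open>Y\<close> are, and one component of the form controls the
  other.\<close>

lemma cj_lin: "cj (lin a b q X Y) = (a + b / d) * cj X - q * cj Y"
proof -
  have "b * ((t - d) * snd X - fst X) = - (b / d) * cj X"
    using d_pos by (simp add: inverse_d[symmetric] cj_def field_simps)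
  then show ?thesis unfolding cj_def lin_def by (simp add: algebra_simps)
qed

text \<open>Substituting \<open>d * fst X = snd X + cj X\<close> separates an integer from a bounded
  remainder. The two inequalities become two thresholds for \<open>b * cj X\<close>.\<close>

lemma floor_rel_lin:
  assumes "real x = real_of_int (fst X)" "real y = real_of_int (fst Y)"
  shows "floor_rel a b a0 b0 q x y \<longleftrightarrow>
     0 \<le> b * cj X + (fst (lin a b q X Y) + a0) + b0 * d \<and>
     \<not> 0 \<le> b * cj X + (fst (lin a b q X Y) + a0 - q) + b0 * d"
  unfolding floor_rel_def assms by (auto simp: cj_def lin_def algebra_simps)

text \<open>Appending a digit maps a threshold \<open>0 \<le> b z + m + n d\<close> with \<open>(m, n)\<close> in a large box to another
  one in the box, or to one whose truth value no longer depends on \<open>z\<close>.\<close>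

lemma threshold_child:
  "0 \<le> b * cj (child X A) + m + n * d \<longleftrightarrow> 0 \<le> b * cj X + (b * A + m * t + n) + (- m) * d"
  for b A m n :: int
proof -
  have "0 \<le> b * cj (child X A) + m + n * d \<longleftrightarrow> 0 \<le> (1 / d) * (b * cj (child X A) + m + n * d)"
    using d_pos by (simp add: zero_le_divide_iff)
  also have "(1 / d) * (b * cj (child X A) + m + n * d) = b * (cj X + A) + m * (1 / d) + n"
    using d_pos by (simp add: cj_child field_simps)
  also have "\<dots> = b * cj X + (b * A + m * t + n) + (- m) * d"
    by (simp only: inverse_d) (simp add: algebra_simps)
  finally show ?thesis by simp
qed

text \<open>Here \<open>z + n * d\<close> is at most \<open>L * (1 - d) + L * d = L\<close> in
  absolute value, so it cannot outweigh \<open>m\<close>.\<close>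

lemma threshold_large:
  fixes z :: real and m n L :: int
  assumes "\<bar>z\<bar> \<le> L * (1 - d)" "L < \<bar>m\<bar>" "\<bar>n\<bar> \<le> L"
  shows "0 \<le> z + m + n * d \<longleftrightarrow> 0 < m"
proof -
  have "\<bar>n * d\<bar> = \<bar>real_of_int n\<bar> * d" using d_pos by (simp add: abs_mult)
  also have "\<dots> \<le> L * d" using assms(3) d_pos by (intro mult_right_mono) linarith+
  finally have "\<bar>z + n * d\<bar> \<le> L" using assms(1) by (simp add: algebra_simps)
  then show ?thesis using assms(2) by linarith
qed

text \<open>For \<open>K = k * C\<close>, the integer pairs with entries up to \<open>2 * K\<close>
  in absolute value number \<open>(4 * K + 1)^2\<close>. One factor \<open>2 ^ (4 * K + 1)^2\<close>
  counts sets of thresholds, the other generously covers the values of the linear form.\<close>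

definition index_bound :: "nat \<Rightarrow> nat \<Rightarrow> nat" where
  "index_bound k C = 2 ^ (2 * (4 * (k * C) + 1)\<^sup>2)"

text \<open>A class consists of the linear form, or \<open>None\<close> once it is too large, and
  the set of true thresholds from a box. All estimates scale with the number of leaves, so one
  \<open>k\<close> serves all terms.\<close>

lemma has_index_floor_rel:
  assumes q: "q > 0"
  shows "\<exists>k. \<forall>u r C. leaves u \<le> C \<longrightarrow> leaves r \<le> C \<longrightarrow> C \<ge> 1 \<longrightarrow>
    has_index (index_bound k C) (\<lambda>e. floor_rel a b a0 b0 q (tm_val e u) (tm_val e r))"
proof -
  define B where "B = \<bar>a\<bar> + \<bar>b\<bar> + q"
  \<comment> \<open>The summands bound, per leaf, the conjugate of the form, the contribution of one
    digit, and the offsets in the two thresholds of the relation. Dividing by \<open>1 - d\<close>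
    meets the needs of both \<open>threshold_large\<close> and the growth of large forms.\<close>
  define c0 where "c0 = (\<bar>a\<bar> + \<bar>b\<bar> / d + q) * window + B * t + (\<bar>a0\<bar> + \<bar>b0\<bar> + q)"
  define k where "k = nat \<lceil>c0 / (1 - d)\<rceil>"
  have k: "c0 \<le> k * (1 - d)"
  proof -
    have "c0 / (1 - d) \<le> k" by (simp add: k_def le_of_int_ceiling real_nat_ceiling_ge)
    then show ?thesis using d_less by (simp add: field_simps)
  qed
  have "has_index (index_bound k C) (\<lambda>e. floor_rel a b a0 b0 q (tm_val e u) (tm_val e r))"
    if C: "leaves u \<le> C" "leaves r \<le> C" "C \<ge> 1" for u r C
  proof -
    define K where "K = int (k * C)"
    define W where "W = (\<bar>a\<bar> + \<bar>b\<bar> / d + q) * (window * C)"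
    have W: "0 \<le> W" using d_pos window_nonneg q by (simp add: W_def)
    have K0: "W + B * (t * C) + (\<bar>a0\<bar> + \<bar>b0\<bar> + q) \<le> K * (1 - d)"
    proof -
      have "W + B * (t * C) + (\<bar>a0\<bar> + \<bar>b0\<bar> + q) \<le> W + B * (t * C) + (\<bar>a0\<bar> + \<bar>b0\<bar> + q) * C"
        using C(3) q mult_left_mono[of 1 "real C" "\<bar>a0\<bar> + \<bar>b0\<bar> + q"] by simp
      also have "\<dots> = c0 * C" by (simp add: W_def c0_def algebra_simps)
      also have "\<dots> \<le> (k * (1 - d)) * C" using k by (intro mult_right_mono) auto
      finally show ?thesis by (simp add: K_def algebra_simps)
    qed
    have BtC: "0 \<le> real_of_int (B * (t * C))" using q t_pos by (simp add: B_def)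
    have Kd: "K * (1 - d) \<le> K" using d_pos by (simp add: K_def algebra_simps)
    define z where "z s = lin a b q (tm_pair s u) (tm_pair s r)" for s
    define zs where "zs s = (if \<bar>fst (z s)\<bar> \<le> K then Some (z s) else None)" for s
    define half where "half s = (\<lambda>(m :: int, n :: int). 0 \<le> b * cj (tm_pair s u) + m + n * d)" for s
    define box where "box L = {- L..L} \<times> {- L..L :: int}" for L
    \<comment> \<open>The size \<open>2 * K\<close> leaves room for \<open>fst (z s)\<close>, up to
      \<open>K\<close>, plus the offsets \<open>a0\<close> and \<open>q\<close>.\<close>
    define hs where "hs s = {p \<in> box (2 * K). half s p}" for s
    have win: "window * leaves u \<le> window * C" "window * leaves r \<le> window * C"
      using C window_nonneg by (auto intro!: mult_left_mono)
    have cju: "\<bar>cj (tm_pair s u)\<bar> \<le> window * C" and cjr: "\<bar>cj (tm_pair s r)\<bar> \<le> window * C"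
      if "s \<in> configs" for s
      using tm_pair_bounds[OF that, of u] tm_pair_bounds[OF that, of r] win by auto
    have cjz: "\<bar>cj (z s)\<bar> \<le> W" if "s \<in> configs" for s
    proof -
      have "\<bar>cj (z s)\<bar> \<le> \<bar>(a + b / d) * cj (tm_pair s u)\<bar> + \<bar>q * cj (tm_pair s r)\<bar>"
        unfolding z_def cj_lin by (rule abs_triangle_ineq4)
      also have "\<dots> = \<bar>a + b / d\<bar> * \<bar>cj (tm_pair s u)\<bar> + q * \<bar>cj (tm_pair s r)\<bar>"
        using q by (simp add: abs_mult)
      also have "\<dots> \<le> (\<bar>a\<bar> + \<bar>b\<bar> / d) * (window * C) + q * (window * C)"
      proof (intro add_mono mult_mono cju cjr that)
        have "\<bar>b / d\<bar> = \<bar>b\<bar> / d" using d_pos by simp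
        then show "\<bar>a + b / d\<bar> \<le> \<bar>a\<bar> + \<bar>b\<bar> / d" by linarith
      qed (use q d_pos in auto)
      also have "\<dots> = W" by (simp add: W_def algebra_simps)
      finally show ?thesis .
    qed
    have bcj: "\<bar>b * cj (tm_pair s u)\<bar> \<le> W" if "s \<in> configs" for s
    proof -
      have "\<bar>real_of_int b\<bar> * d \<le> \<bar>real_of_int b\<bar>" using d_less by (simp add: mult_left_le)
      then have "\<bar>real_of_int b\<bar> \<le> \<bar>real_of_int b\<bar> / d" using d_pos by (simp add: field_simps)
      then have "\<bar>real_of_int b\<bar> \<le> \<bar>real_of_int a\<bar> + \<bar>real_of_int b\<bar> / d + real_of_int q"
        using q by linarith
      then have "\<bar>real_of_int b\<bar> * \<bar>cj (tm_pair s u)\<bar> \<le>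
          (\<bar>real_of_int a\<bar> + \<bar>real_of_int b\<bar> / d + real_of_int q) * (window * C)"
        using q d_pos by (intro mult_mono cju that) auto
      then show ?thesis by (simp add: W_def abs_mult)
    qed
    have snd_z: "\<bar>snd (z s)\<bar> \<le> d * \<bar>fst (z s)\<bar> + W" if "s \<in> configs" for s
    proof -
      have "\<bar>d * fst (z s)\<bar> = d * \<bar>fst (z s)\<bar>" using d_pos by (simp add: abs_mult)
      then show ?thesis using cjz[OF that] unfolding cj_def by linarith
    qed
    \<comment> \<open>The bounded conjugate carries the bound on the first component over to the
      second.\<close>
    have z_box: "z s \<in> box K" if s: "s \<in> configs" "\<bar>fst (z s)\<bar> \<le> K" for s
    proof -
      have "d * \<bar>fst (z s)\<bar> \<le> d * K" using s(2) d_pos by (intro mult_left_mono) linarith+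
      then have "\<bar>snd (z s)\<bar> \<le> real_of_int K"
        using snd_z[OF s(1)] K0 BtC q by (simp add: algebra_simps)
      then have "\<bar>snd (z s)\<bar> \<le> K" by linarith
      then show ?thesis using s(2) by (cases "z s") (auto simp: box_def)
    qed
    have half_eq: "half s p \<longleftrightarrow> half s' p"
      if "(zs s, hs s) = (zs s', hs s')" "p \<in> box (2 * K)" for s s' p
    proof -
      have "p \<in> hs s \<longleftrightarrow> p \<in> hs s'" using that(1) by simp
      then show ?thesis using that(2) by (simp add: hs_def)
    qed
    let ?S = "insert None (Some ` box K) \<times> Pow (box (2 * K))"
    show ?thesis
    proof (rule has_indexI[where f = "\<lambda>s. (zs s, hs s)" and S = ?S])
      show "finite ?S" by (simp add: box_def)
      show "card ?S \<le> index_bound k C"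
      proof -
        have "card ?S \<le> Suc (card (box K)) * 2 ^ card (box (2 * K))"
          by (simp add: card_cartesian_product card_Pow box_def card_insert_if card_image)
        also have "\<dots> \<le> 2 ^ card (box (2 * K)) * 2 ^ card (box (2 * K))"
        proof (intro mult_right_mono)
          have "card (box K) \<le> card (box (2 * K))"
            by (intro card_mono) (auto simp: box_def K_def)
          moreover have "n < 2 ^ n" for n :: nat by (rule less_exp)
          ultimately show "Suc (card (box K)) \<le> 2 ^ card (box (2 * K))"
            by (meson Suc_leI le_less_trans)
        qed simp
        also have "\<dots> = 2 ^ (2 * card (box (2 * K)))" by (simp only: mult_2 power_add)
        also have "card (box (2 * K)) = (4 * (k * C) + 1)\<^sup>2"
          unfolding box_def by (subst card_box) (simp_all add: K_def nat_add_distrib nat_mult_distrib)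
        finally show ?thesis by (simp add: index_bound_def)
      qed
    next
      fix s assume "s \<in> configs"
      then show "(zs s, hs s) \<in> ?S" using z_box by (auto simp: zs_def hs_def)
    next
      fix s s' assume s: "s \<in> configs" "s' \<in> configs" and eq: "(zs s, hs s) = (zs s', hs s')"
      have rel: "floor_rel a b a0 b0 q (tm_val (env_of s) u) (tm_val (env_of s) r) \<longleftrightarrow>
          half s (fst (z s) + a0, b0) \<and> \<not> half s (fst (z s) + a0 - q, b0)" if "s \<in> configs" for s
        unfolding half_def z_def prod.case
        by (subst floor_rel_lin[OF real_tm_val[OF that] real_tm_val[OF that]])
          (simp only: of_int_add of_int_diff)
      assume f: "floor_rel a b a0 b0 q (tm_val (env_of s) u) (tm_val (env_of s) r)"
      \<comment> \<open>A true relation confines the integer part, so the class \<open>None\<close>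
        contains only false instances.\<close>
      have "\<bar>fst (z s)\<bar> \<le> K"
      proof -
        have "\<bar>b0 * d\<bar> = \<bar>b0\<bar> * d" using d_pos by (simp add: abs_mult)
        also have "\<dots> \<le> \<bar>b0\<bar>" using d_less by (simp add: mult_left_le)
        finally have "\<bar>real_of_int (fst (z s))\<bar> \<le> W + (\<bar>a0\<bar> + \<bar>b0\<bar> + q)"
          using f bcj[OF s(1)] unfolding rel[OF s(1)] half_def by auto
        then have "real_of_int \<bar>fst (z s)\<bar> \<le> real_of_int K" using K0 BtC Kd by simp
        then show ?thesis by linarith
      qed
      then have zeq: "z s' = z s" using eq by (auto simp: zs_def split: if_splits)
      have "\<bar>a0\<bar> + \<bar>b0\<bar> + q \<le> real_of_int K" using K0 BtC Kd W by linarith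
      then have "\<bar>a0\<bar> + \<bar>b0\<bar> + q \<le> K" by linarith
      then have "(fst (z s) + a0, b0) \<in> box (2 * K)" "(fst (z s) + a0 - q, b0) \<in> box (2 * K)"
        using \<open>\<bar>fst (z s)\<bar> \<le> K\<close> q by (auto simp: box_def)
      moreover have "half s p \<longleftrightarrow> half s' p" if "p \<in> box (2 * K)" for p
        using half_eq[OF eq that] .
      ultimately show "floor_rel a b a0 b0 q (tm_val (env_of s') u) (tm_val (env_of s') r)"
        using f unfolding rel[OF s(1)] rel[OF s(2)] zeq by simp
    next
      fix s s' e assume s: "s \<in> configs" "s' \<in> configs" and eq: "(zs s, hs s) = (zs s', hs s')"
        and e: "e \<in> letters"
      let ?A = "tm_int e u" and ?A' = "tm_int e r"
      have z_next: "z (next_config s e) =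
          (t * fst (z s) - snd (z s) + (a * ?A - q * ?A'), fst (z s) - b * ?A)" for s
        by (simp add: z_def tm_pair_next lin_child)
      \<comment> \<open>The new first component is at least
        \<open>(t - d) * \<bar>fst (z s)\<bar>\<close> minus the conjugate and digit bounds. Beyond
        \<open>K\<close> the surplus factor \<open>t - d - 1 = 1 / d - 1 >= 1 - d\<close> outweighs
        these losses.\<close>
      have sink: "zs (next_config s e) = None" if "s \<in> configs" "zs s = None" for s
      proof -
        have gt: "K < \<bar>fst (z s)\<bar>" using that(2) by (simp add: zs_def split: if_splits)
        have A: "\<bar>?A\<bar> \<le> t * C" "\<bar>?A'\<bar> \<le> t * C"
        proof -
          have "t * leaves u \<le> t * C" "t * leaves r \<le> t * C"
            using C t_pos by (auto intro!: mult_left_mono)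
          then show "\<bar>?A\<bar> \<le> t * C" "\<bar>?A'\<bar> \<le> t * C"
            using tm_int_letters[OF e, of u] tm_int_letters[OF e, of r] by auto
        qed
        have "\<bar>a * ?A - q * ?A'\<bar> \<le> \<bar>a\<bar> * \<bar>?A\<bar> + q * \<bar>?A'\<bar>"
          using q abs_triangle_ineq4[of "a * ?A" "q * ?A'"] by (simp add: abs_mult)
        also have "\<dots> \<le> \<bar>a\<bar> * (t * C) + q * (t * C)"
          using A q by (intro add_mono mult_left_mono) auto
        also have "\<dots> \<le> B * (t * C)" using t_pos by (simp add: B_def distrib_right)
        finally have al: "real_of_int \<bar>a * ?A - q * ?A'\<bar> \<le> real_of_int (B * (t * C))"
          by (simp only: of_int_le_iff)
        have "(t - d) * \<bar>fst (z s)\<bar> = \<bar>fst (z s)\<bar> / d" by (simp add: inverse_d[symmetric])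
        have "d * (1 - d) \<le> 1 - d" using d_less by (simp add: mult_left_le_one_le d_pos less_imp_le)
        then have "1 - d \<le> 1 / d - 1" using d_pos by (simp add: field_simps)
        then have "(1 - d) * \<bar>real_of_int (fst (z s))\<bar> \<le> (t - d - 1) * \<bar>real_of_int (fst (z s))\<bar>"
          by (intro mult_right_mono) (simp_all add: inverse_d)
        moreover have "K * (1 - d) < (1 - d) * \<bar>real_of_int (fst (z s))\<bar>"
          using gt d_less by (subst mult.commute) (intro mult_strict_left_mono, linarith+)
        ultimately have "W + real_of_int (B * (t * C)) < (t - d - 1) * \<bar>real_of_int (fst (z s))\<bar>"
          using K0 q by linarith
        then have "\<bar>real_of_int (fst (z s))\<bar> <
            t * \<bar>real_of_int (fst (z s))\<bar> - (d * \<bar>real_of_int (fst (z s))\<bar> + W) - real_of_int (B * (t * C))"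
          by (simp add: algebra_simps)
        also have "t * \<bar>real_of_int (fst (z s))\<bar> = \<bar>t * real_of_int (fst (z s))\<bar>"
          using t_pos by (simp add: abs_mult)
        also have "\<bar>t * real_of_int (fst (z s))\<bar> - (d * \<bar>real_of_int (fst (z s))\<bar> + W) - real_of_int (B * (t * C))
            \<le> \<bar>real_of_int (fst (z (next_config s e)))\<bar>"
          using snd_z[OF that(1)] al unfolding z_next by simp
        finally have "\<bar>fst (z s)\<bar> < \<bar>fst (z (next_config s e))\<bar>" by linarith
        then show ?thesis using gt by (simp add: zs_def)
      qed
      have "zs (next_config s e) = zs (next_config s' e)"
      proof (cases "zs s")
        case None
        then show ?thesis using sink[OF s(1)] sink[OF s(2)] eq by simp
      next
        case (Some p)
        then have "z s = z s'" using eq by (auto simp: zs_def split: if_splits)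
        then show ?thesis by (simp add: zs_def z_next)
      qed
      \<comment> \<open>Pulled back along the digit, the threshold either lies in the box, where
        both configurations agree, or is decided by the sign of its integer part.\<close>
      moreover have "half (next_config s e) p \<longleftrightarrow> half (next_config s' e) p" if p: "p \<in> box (2 * K)" for p
      proof -
        obtain m n where mn: "p = (m, n)" by (cases p)
        let ?m = "b * ?A + m * t + n"
        have step: "half (next_config s e) p \<longleftrightarrow> half s (?m, - m)" for s
          unfolding half_def mn prod.case tm_pair_next threshold_child by simp
        have "half s (?m, - m) \<longleftrightarrow> half s' (?m, - m)"
        proof (cases "\<bar>?m\<bar> \<le> 2 * K")
          case True
          then have "(?m, - m) \<in> box (2 * K)" using p by (auto simp: box_def mn)
          then show ?thesis by (rule half_eq[OF eq])
        next
          case False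
          have "half s (?m, - m) \<longleftrightarrow> 0 < ?m" if "s \<in> configs" for s
            unfolding half_def prod.case
          proof (rule threshold_large[where L = "2 * K"])
            have "0 \<le> K * (1 - d)" using d_less by (simp add: K_def)
            then show "\<bar>b * cj (tm_pair s u)\<bar> \<le> real_of_int (2 * K) * (1 - d)"
              using bcj[OF that] K0 BtC q by simp
          qed (use False p in \<open>auto simp: box_def mn\<close>)
          then show ?thesis using s by blast
        qed
        then show ?thesis by (simp add: step)
      qed
      ultimately show "(zs (next_config s e), hs (next_config s e)) = (zs (next_config s' e), hs (next_config s' e))"
        unfolding hs_def by blast
    qed
  qed
  then show ?thesis by blast
qed

end

section \<open>Bounding the index by the code of a formula\<close>

lemma leaves_le_code: "leaves u \<le> Suc (tm_code u)"
proof (induction u)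
  case (Plus u r)
  then show ?case
    using add_le_prod_encode[of "tm_code u" "tm_code r"]
      add_le_prod_encode[of 1 "prod_encode (tm_code u, tm_code r)"] by simp
qed simp

context quadratic_unit
begin

lemma index_bound_mono:
  assumes "k \<le> k'" "C \<le> C'"
  shows "index_bound k C \<le> index_bound k' C'"
proof -
  have "k * C \<le> k' * C'" using assms by (rule mult_le_mono)
  then show ?thesis
    unfolding index_bound_def by (intro power_increasing mult_le_mono2 power_mono add_right_mono) auto
qed

text \<open>The three summands dominate the index of an atom, of \<open>Ex\<close> and of
  \<open>Conj\<close>. Recursion on the code instead of the formula makes the bound monotone and
  primitive recursive. The argument \<open>Suc (Suc c)\<close> is the bound on leaves at code
  \<open>Suc c\<close>.\<close>

definition fm_index :: "nat \<Rightarrow> nat \<Rightarrow> nat" where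
  "fm_index k = rec_nat (index_bound k 1)
     (\<lambda>c r. index_bound k (Suc (Suc c)) + (2 ^ r + r * r))"

lemma fm_index_Suc:
  "fm_index k (Suc c) = index_bound k (Suc (Suc c)) + (2 ^ fm_index k c + fm_index k c * fm_index k c)"
  by (simp add: fm_index_def)

lemma index_bound_le_fm_index: "index_bound k (Suc c) \<le> fm_index k c"
  by (cases c) (simp_all add: fm_index_def)

lemma fm_index_mono:
  assumes "c \<le> c'"
  shows "fm_index k c \<le> fm_index k c'"
proof (rule lift_Suc_mono_le[of "fm_index k", OF _ assms])
  show "fm_index k c \<le> fm_index k (Suc c)" for c
    using less_exp[of "fm_index k c"] unfolding fm_index_Suc by linarith
qed

lemma fm_index_step:
  assumes "c < c'"
  shows "2 ^ fm_index k c \<le> fm_index k c'" "b < c' \<Longrightarrow> fm_index k c * fm_index k b \<le> fm_index k c'"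
proof -
  obtain c1 where c1: "c' = Suc c1" using assms by (cases c') auto
  have c: "fm_index k c \<le> fm_index k c1" using assms by (intro fm_index_mono) (simp add: c1)
  then have "(2 :: nat) ^ fm_index k c \<le> 2 ^ fm_index k c1" by (intro power_increasing) auto
  then show "2 ^ fm_index k c \<le> fm_index k c'" unfolding c1 fm_index_Suc by linarith
  assume "b < c'"
  then have "fm_index k b \<le> fm_index k c1" by (intro fm_index_mono) (simp add: c1)
  then have "fm_index k c * fm_index k b \<le> fm_index k c1 * fm_index k c1" by (intro mult_le_mono c)
  then show "fm_index k c * fm_index k b \<le> fm_index k c'" unfolding c1 fm_index_Suc by linarith
qed

text \<open>Equality is the case \<open>\<alpha> = 1\<close>, \<open>\<beta> = 0\<close>, so it
  needs no congruence of its own.\<close>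

lemma floor_rel_eq: "floor_rel 1 0 0 0 1 x y \<longleftrightarrow> x = y"
  by (auto simp: floor_rel_def)

lemma has_index_sat:
  assumes "q > 0"
  shows "\<exists>k. \<forall>p. has_index (fm_index k (fm_code p))
    (\<lambda>e. sat {(x, y). floor_rel a b a0 b0 q x y} e p)"
proof -
  define R where "R = {(x, y). floor_rel a b a0 b0 q x y}"
  obtain k1 where k1: "\<And>u r C. leaves u \<le> C \<Longrightarrow> leaves r \<le> C \<Longrightarrow> C \<ge> 1 \<Longrightarrow>
      has_index (index_bound k1 C) (\<lambda>e. floor_rel 1 0 0 0 1 (tm_val e u) (tm_val e r))"
    using has_index_floor_rel[of 1 1 0 0 0] by auto
  obtain k2 where k2: "\<And>u r C. leaves u \<le> C \<Longrightarrow> leaves r \<le> C \<Longrightarrow> C \<ge> 1 \<Longrightarrow>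
      has_index (index_bound k2 C) (\<lambda>e. floor_rel a b a0 b0 q (tm_val e u) (tm_val e r))"
    using has_index_floor_rel[OF assms, of a b a0 b0] by auto
  define k where "k = k1 + k2"
  have atom: "leaves u \<le> Suc c \<and> leaves r \<le> Suc c" if "c = prod_encode (i, prod_encode (tm_code u, tm_code r))"
    for u r c i
    using pair_le_code[where a = "tm_code u" and b = "tm_code r" and k = i]
      leaves_le_code[of u] leaves_le_code[of r] that by linarith
  have mono: "index_bound k1 (Suc c) \<le> fm_index k c" "index_bound k2 (Suc c) \<le> fm_index k c" for c
    using index_bound_le_fm_index[of k c] index_bound_mono[of k1 k "Suc c" "Suc c"]
      index_bound_mono[of k2 k "Suc c" "Suc c"] by (simp_all add: k_def)
  have "has_index (fm_index k (fm_code p)) (\<lambda>e. sat R e p)" for p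
  proof (induction p)
    case (Eq u r)
    have "has_index (index_bound k1 (Suc (fm_code (Eq u r)))) (\<lambda>e. tm_val e u = tm_val e r)"
      using k1[of u "Suc (fm_code (Eq u r))" r] atom[of "fm_code (Eq u r)" 0 u r]
      unfolding floor_rel_eq by simp
    then show ?case unfolding sat.simps by (rule has_index_mono) (rule mono)
  next
    case (Rel u r)
    have "has_index (index_bound k2 (Suc (fm_code (Rel u r))))
        (\<lambda>e. floor_rel a b a0 b0 q (tm_val e u) (tm_val e r))"
      using k2[of u "Suc (fm_code (Rel u r))" r] atom[of "fm_code (Rel u r)" 1 u r] by simp
    then show ?case
      unfolding sat.simps R_def mem_Collect_eq prod.case by (rule has_index_mono) (rule mono)
  next
    case (Neg p)
    have "fm_index k (fm_code p) \<le> fm_index k (fm_code (Neg p))"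
      by (rule fm_index_mono) (simp add: code_less less_imp_le)
    then show ?case
      unfolding sat.simps by (rule has_index_mono[OF has_index_Not[OF Neg.IH]])
  next
    case (Conj p r)
    have "fm_index k (fm_code p) * fm_index k (fm_code r) \<le> fm_index k (fm_code (Conj p r))"
      by (rule fm_index_step(2)) (simp_all add: code_less)
    then show ?case
      unfolding sat.simps by (rule has_index_mono[OF has_index_Conj[OF Conj.IH]])
  next
    case (Ex i p)
    have "2 ^ fm_index k (fm_code p) \<le> fm_index k (fm_code (Ex i p))"
      by (rule fm_index_step(1)) (simp add: code_less)
    then show ?case
      unfolding sat.simps by (rule has_index_mono[OF has_index_Ex[OF Ex.IH]])
  qed
  then show ?thesis unfolding R_def by (intro exI[of _ k] allI)
qed

text \<open>Turns a comparison with the irrational \<open>d\<close> into arithmetic on naturals: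
  \<open>v^2 - t v x + x^2\<close> factors as \<open>(v - d x) (v - x / d)\<close>, and the second
  factor is negative if \<open>x > v\<close>.\<close>

lemma greater_iff_quadratic:
  assumes "v > 0"
  shows "d * real x < real v \<longleftrightarrow> x \<le> v \<or> v * v + x * x < nat t * v * x"
proof (cases "x \<le> v")
  case True
  have "d * real x < real v"
  proof (cases "x = 0")
    case False
    then have "d * real x < real x" using d_less by simp
    then show ?thesis using True by linarith
  qed (use assms in simp)
  then show ?thesis using True by simp
next
  case False
  have "real v < real x" using False by simp
  also have "\<dots> \<le> (1 / d) * real x"
    using d_pos d_less mult_right_mono[of 1 "1 / d" "real x"] by simp
  finally have neg: "real v - (1 / d) * real x < 0" by simp
  have "v * v + x * x < nat t * v * x \<longleftrightarrow> real (v * v + x * x) < real (nat t * v * x)"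
    by (simp only: of_nat_less_iff)
  also have "\<dots> \<longleftrightarrow> real v * real v + real x * real x < (d + 1 / d) * real v * real x"
    using t_pos by (simp add: inverse_d)
  also have "\<dots> \<longleftrightarrow> (real v - d * real x) * (real v - (1 / d) * real x) < 0"
    using d_pos by (simp add: field_simps)
  also have "\<dots> \<longleftrightarrow> d * real x < real v"
    using neg by (auto simp: mult_less_0_iff)
  finally show ?thesis using False by simp
qed

lemma Least_eq_floor:
  "(LEAST y. x \<le> Suc y \<or> Suc y * Suc y + x * x < nat t * Suc y * x) = nat \<lfloor>d * x\<rfloor>"
proof (rule Least_equality)
  have "d * real x < real (Suc (nat \<lfloor>d * x\<rfloor>))" using d_pos by (simp add: of_nat_floor) linarith
  then show "x \<le> Suc (nat \<lfloor>d * x\<rfloor>) \<or>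
      Suc (nat \<lfloor>d * x\<rfloor>) * Suc (nat \<lfloor>d * x\<rfloor>) + x * x < nat t * Suc (nat \<lfloor>d * x\<rfloor>) * x"
    using greater_iff_quadratic[of "Suc (nat \<lfloor>d * x\<rfloor>)" x] by blast
next
  fix y assume "x \<le> Suc y \<or> Suc y * Suc y + x * x < nat t * Suc y * x"
  then have "d * real x < real (Suc y)" using greater_iff_quadratic[of "Suc y" x] by blast
  then show "nat \<lfloor>d * x\<rfloor> \<le> y" by (simp add: nat_le_iff floor_le_iff)
qed

lemma computable_floor:
  assumes "computable f"
  shows "computable (\<lambda>e. nat \<lfloor>d * f e\<rfloor>)"
proof (rule computable_call1[OF _ assms])
  have "computable (\<lambda>e. LEAST y. e 0 \<le> Suc y \<or> Suc y * Suc y + e 0 * e 0 < nat t * Suc y * e 0)"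
  proof (intro computable_Least computable_intros)
    show "\<exists>y. e 0 \<le> Suc y \<or> Suc y * Suc y + e 0 * e 0 < nat t * Suc y * e 0" for e :: "nat \<Rightarrow> nat"
      by (intro exI[of _ "e 0"]) simp
  qed
  then show "computable (\<lambda>e. nat \<lfloor>d * e 0\<rfloor>)" by (simp only: Least_eq_floor)
qed

text \<open>Reduces signs in \<open>\<int> + \<int> d\<close> to natural arithmetic and
  \<open>\<lfloor>d * n\<rfloor>\<close>, already known to be computable.\<close>

lemma le_iff_floor:
  "real m2 + real n2 * d \<le> real m1 + real n1 * d \<longleftrightarrow>
     (if n2 \<le> n1 then m2 \<le> m1 + nat \<lfloor>d * (n1 - n2)\<rfloor> else m2 + nat \<lfloor>d * (n2 - n1)\<rfloor> < m1)"
proof (cases "n2 \<le> n1")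
  case True
  have "real m2 + real n2 * d \<le> real m1 + real n1 * d \<longleftrightarrow> real_of_int (int m2 - int m1) \<le> d * (n1 - n2)"
    using True by (simp add: of_nat_diff algebra_simps)
  also have "\<dots> \<longleftrightarrow> int m2 - int m1 \<le> \<lfloor>d * (n1 - n2)\<rfloor>" by (rule le_floor_iff[symmetric])
  also have "\<dots> \<longleftrightarrow> m2 \<le> m1 + nat \<lfloor>d * (n1 - n2)\<rfloor>" using d_pos 
  proof -
    have "0 \<le> \<lfloor>d * (n1 - n2)\<rfloor>" using d_pos by simp
    then show ?thesis by linarith
  qed
  finally show ?thesis using True by simp
next
  case False
  define z where "z = d * (n2 - n1)"
  \<comment> \<open>Irrationality of \<open>d\<close> turns the non-strict comparison with an
    integer into a strict one, which the floor can decide.\<close>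
  have "z \<notin> \<int>"
  proof
    assume "z \<in> \<int>"
    then have "z / (n2 - n1) \<in> \<rat>" using Ints_subset_Rats by (intro Rats_divide) auto
    then show False using d_irrat False by (simp add: z_def)
  qed
  then have "z \<noteq> real_of_int i" for i by (metis Ints_of_int)
  have "real m2 + real n2 * d \<le> real m1 + real n1 * d \<longleftrightarrow> z \<le> real_of_int (int m1 - int m2)"
    using False by (simp add: z_def of_nat_diff algebra_simps)
  also have "\<dots> \<longleftrightarrow> z < real_of_int (int m1 - int m2)"
    using \<open>\<And>i. z \<noteq> real_of_int i\<close>[of "int m1 - int m2"] by linarith
  also have "\<dots> \<longleftrightarrow> \<lfloor>z\<rfloor> < int m1 - int m2" by (rule floor_less_iff[symmetric])
  also have "\<dots> \<longleftrightarrow> m2 + nat \<lfloor>z\<rfloor> < m1" 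
  proof -
    have "0 \<le> \<lfloor>z\<rfloor>" using d_pos by (simp add: z_def)
    then show ?thesis by linarith
  qed
  finally show ?thesis using False by (simp add: z_def)
qed

lemma computable_pred_floor_rel:
  assumes "q > 0"
  shows "computable_pred (\<lambda>e. (e 0, e 1) \<in> {(x, y). floor_rel a b a0 b0 q x y})"
proof -
  \<comment> \<open>Positive and negative parts of the integer coefficients go to opposite sides, so
    that only natural numbers occur.\<close>
  let ?m1 = "\<lambda>e :: nat \<Rightarrow> nat. nat a * e 0 + nat a0"
  let ?m2 = "\<lambda>e :: nat \<Rightarrow> nat. nat (- a) * e 0 + nat (- a0) + nat q * e 1"
  let ?n1 = "\<lambda>e :: nat \<Rightarrow> nat. nat b * e 0 + nat b0"
  let ?n2 = "\<lambda>e :: nat \<Rightarrow> nat. nat (- b) * e 0 + nat (- b0)"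
  have pn: "real (nat i) = real (nat (- i)) + i" for i by (cases "i \<ge> 0") auto
  have "floor_rel a b a0 b0 q (e 0) (e 1) \<longleftrightarrow>
      real (?m2 e) + real (?n2 e) * d \<le> real (?m1 e) + real (?n1 e) * d \<and>
      \<not> real (?m2 e + nat q) + real (?n2 e) * d \<le> real (?m1 e) + real (?n1 e) * d" for e
    using assms unfolding floor_rel_def of_nat_add of_nat_mult pn[of a] pn[of b] pn[of a0] pn[of b0]
    by (auto simp: algebra_simps)
  moreover have "computable_pred (\<lambda>e. \<not> real (?m2 e + nat q) + real (?n2 e) * d \<le> real (?m1 e) + real (?n1 e) * d)"
    "computable_pred (\<lambda>e. real (?m2 e) + real (?n2 e) * d \<le> real (?m1 e) + real (?n1 e) * d)"
    unfolding le_iff_floor if_bool_eq_conj imp_conv_disj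
    by (intro computable_intros computable_floor)+
  ultimately show ?thesis by (simp add: computable_pred_conj)
qed

theorem decidable_floor_rel:
  assumes "q > 0"
  shows "decidable (fm_code ` true_sentences {(x, y). floor_rel a b a0 b0 q x y})"
proof -
  let ?R = "{(x, y). floor_rel a b a0 b0 q x y}"
  obtain k where k: "\<And>p. has_index (fm_index k (fm_code p)) (\<lambda>e. sat ?R e p)"
    using has_index_sat[OF assms] by blast
  define bnd where "bnd c m = (2 * nat t) ^ (fm_index k c + m)" for c m
  show ?thesis
  proof (rule decidable_if_bounded_witnesses)
    show "computable_pred (\<lambda>e. (e 0, e 1) \<in> ?R)"
      by (rule computable_pred_floor_rel[OF assms])
    show "computable (\<lambda>e. bnd (e 0) (e 1))"
      unfolding bnd_def fm_index_def index_bound_def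
      by (intro computable_intros computable_rec_nat)
    show "bnd c m \<le> bnd c' m" if "c \<le> c'" for c c' m
      using fm_index_mono[OF that, of k] t_pos unfolding bnd_def
      by (intro power_increasing add_right_mono) auto
    show "\<exists>n\<le>bnd (fm_code p) m. sat ?R (e(i := n)) p"
      if "\<And>j. e j \<le> m" "sat ?R (e(i := n)) p" for p i e m n
      unfolding bnd_def by (rule bounded_witness[OF k that])
  qed
qed

section \<open>From coefficients in the field to integer coefficients\<close>

definition quadratic_field :: "real set" where
  "quadratic_field = {r + s * d |r s. r \<in> \<rat> \<and> s \<in> \<rat>}"

lemma quadratic_fieldI: "r \<in> \<rat> \<Longrightarrow> s \<in> \<rat> \<Longrightarrow> r + s * d \<in> quadratic_field"
  unfolding quadratic_field_def by blast

lemma quadratic_fieldE: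
  assumes "u \<in> quadratic_field"
  obtains r s where "r \<in> \<rat>" "s \<in> \<rat>" "u = r + s * d"
  using assms unfolding quadratic_field_def by blast

lemma quadratic_field_rat: "r \<in> \<rat> \<Longrightarrow> r \<in> quadratic_field"
  using quadratic_fieldI[of r 0] by simp

lemma quadratic_field_d: "d \<in> quadratic_field"
  using quadratic_fieldI[of 0 1] by simp

lemma quadratic_field_add: "u \<in> quadratic_field \<Longrightarrow> v \<in> quadratic_field \<Longrightarrow> u + v \<in> quadratic_field"
proof (elim quadratic_fieldE)
  fix r s r' s' assume "r \<in> \<rat>" "s \<in> \<rat>" "r' \<in> \<rat>" "s' \<in> \<rat>" and uv: "u = r + s * d" "v = r' + s' * d"
  then have "(r + r') + (s + s') * d \<in> quadratic_field" by (intro quadratic_fieldI) simp_all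
  then show ?thesis by (simp add: uv algebra_simps)
qed

lemma quadratic_field_mult: "u \<in> quadratic_field \<Longrightarrow> v \<in> quadratic_field \<Longrightarrow> u * v \<in> quadratic_field"
proof (elim quadratic_fieldE)
  fix r s r' s' assume "r \<in> \<rat>" "s \<in> \<rat>" "r' \<in> \<rat>" "s' \<in> \<rat>" and uv: "u = r + s * d" "v = r' + s' * d"
  then have "(r * r' - s * s') + (r * s' + s * r' + s * s' * t) * d \<in> quadratic_field"
    by (intro quadratic_fieldI) simp_all
  also have "(r * r' - s * s') + (r * s' + s * r' + s * s' * t) * d =
      r * r' + (r * s' + s * r') * d + s * s' * (t * d - 1)"
    by (simp add: algebra_simps)
  also have "t * d - 1 = d * d" using d_eq by simp
  finally show ?thesis by (simp add: uv algebra_simps)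
qed

lemma quadratic_field_uminus: "u \<in> quadratic_field \<Longrightarrow> - u \<in> quadratic_field"
  using quadratic_field_mult[of "- 1" u] quadratic_field_rat[of "- 1"] by simp

lemma quadratic_field_inverse:
  assumes "u \<in> quadratic_field" "u \<noteq> 0"
  shows "inverse u \<in> quadratic_field"
proof -
  obtain r s where rs: "r \<in> \<rat>" "s \<in> \<rat>" "u = r + s * d" using assms(1) by (rule quadratic_fieldE)
  \<comment> \<open>The conjugate of \<open>u\<close>, with \<open>d\<close> replaced by
    \<open>t - d\<close>; the product \<open>u * v\<close> is the rational norm.\<close>
  define v where "v = (r + s * t) + (- s) * d"
  have v: "v \<in> quadratic_field" using rs unfolding v_def by (intro quadratic_fieldI) simp_all
  have "v \<noteq> 0"
  proof
    assume "v = 0"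
    show False
    proof (cases "s = 0")
      case True
      then show False using \<open>v = 0\<close> assms(2) rs(3) by (simp add: v_def)
    next
      case False
      then have "d = (r + s * t) / s" using \<open>v = 0\<close> by (simp add: v_def field_simps)
      then show False using d_irrat rs by simp
    qed
  qed
  have "u * v = r * r + r * s * t + s * s * (t * d - d * d)"
    by (simp add: rs(3) v_def algebra_simps)
  also have "t * d - d * d = 1" using d_eq by simp
  finally have "u * v \<in> \<rat>" using rs by simp
  then have "v * inverse (u * v) \<in> quadratic_field"
    by (intro quadratic_field_mult[OF v] quadratic_field_rat Rats_inverse)
  then show ?thesis using \<open>v \<noteq> 0\<close> assms(2) by (simp add: field_simps)
qed

lemma rat_adjoin_subset:
  assumes "x \<in> quadratic_field"
  shows "rat_adjoin x \<subseteq> quadratic_field"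
proof
  fix u assume "u \<in> rat_adjoin x"
  then show "u \<in> quadratic_field"
    by induction
      (auto intro: assms quadratic_field_rat quadratic_field_add quadratic_field_uminus quadratic_field_mult
        quadratic_field_inverse)
qed

lemma decidable_floor:
  assumes "\<alpha> \<in> quadratic_field" "\<beta> \<in> quadratic_field"
  shows "decidable (fm_code ` true_sentences {(n, y). int y = \<lfloor>real n * \<alpha> + \<beta>\<rfloor>})"
proof -
  obtain r s where rs: "r \<in> \<rat>" "s \<in> \<rat>" "\<alpha> = r + s * d" using assms(1) by (rule quadratic_fieldE)
  obtain r' s' where rs': "r' \<in> \<rat>" "s' \<in> \<rat>" "\<beta> = r' + s' * d" using assms(2) by (rule quadratic_fieldE)
  have frac: "\<exists>(i :: int) (j :: int). 0 < j \<and> x * real_of_int j = real_of_int i" if x: "x \<in> \<rat>" for x :: real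
  proof -
    obtain i j :: int where "0 < j" "x = real_of_int i / real_of_int j"
      using Rats_cases'[OF x] by blast
    then show ?thesis by (intro exI[of _ i] exI[of _ j]) simp
  qed
  obtain i1 j1 i2 j2 i3 j3 i4 j4 :: int where
    j: "j1 > 0" "j2 > 0" "j3 > 0" "j4 > 0"
    and ij: "r * j1 = i1" "s * j2 = i2" "r' * j3 = i3" "s' * j4 = i4"
    using frac[OF rs(1)] frac[OF rs(2)] frac[OF rs'(1)] frac[OF rs'(2)] by metis
  define q where "q = j1 * j2 * j3 * j4"
  have q: "q > 0" using j by (simp add: q_def)
  let ?a = "i1 * j2 * j3 * j4" and ?b = "i2 * j1 * j3 * j4"
  let ?c = "i3 * j1 * j2 * j4" and ?g = "i4 * j1 * j2 * j3"
  have eqs: "real_of_int ?a = q * r" "real_of_int ?b = q * s" "real_of_int ?c = q * r'" "real_of_int ?g = q * s'"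
    by (simp_all add: q_def ij[symmetric])
  have "floor_rel ?a ?b ?c ?g q n y \<longleftrightarrow> int y = \<lfloor>real n * \<alpha> + \<beta>\<rfloor>" for n y
  proof -
    have "(?a + ?b * d) * n + (?c + ?g * d) - q * y = q * (real n * \<alpha> + \<beta> - y)"
      unfolding eqs rs(3) rs'(3) by (simp add: algebra_simps)
    then have "floor_rel ?a ?b ?c ?g q n y \<longleftrightarrow>
        0 \<le> q * (real n * \<alpha> + \<beta> - y) \<and> q * (real n * \<alpha> + \<beta> - y) < q * 1"
      unfolding floor_rel_def by simp
    also have "\<dots> \<longleftrightarrow> 0 \<le> real n * \<alpha> + \<beta> - y \<and> real n * \<alpha> + \<beta> - y < 1"
      using q by (simp only: zero_le_mult_iff mult_less_cancel_left_pos of_int_0_less_iff) auto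
    also have "\<dots> \<longleftrightarrow> \<lfloor>real n * \<alpha> + \<beta>\<rfloor> = int y"
      by (simp add: floor_eq_iff) linarith
    finally show ?thesis by auto
  qed
  then show ?thesis using decidable_floor_rel[OF q, of ?a ?b ?c ?g] by simp
qed

end

section \<open>The unit of a purely periodic continued fraction\<close>

lemma cf_convergent_ge_1: "(\<And>i. a i \<ge> 1) \<Longrightarrow> cf_convergent a n \<ge> 1"
proof (induction n arbitrary: a)
  case 0
  then show ?case using 0[of 0] by simp
next
  case (Suc n)
  have "cf_convergent (\<lambda>i. a (Suc i)) n \<ge> 1" by (rule Suc.IH) (rule Suc.prems)
  then have "1 / cf_convergent (\<lambda>i. a (Suc i)) n \<ge> 0" by simp
  moreover have "real_of_int (a 0) \<ge> 1" using Suc.prems[of 0] by simp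
  ultimately show ?case unfolding cf_convergent.simps by linarith
qed

text \<open>The coefficients are those of the product of the matrices with rows
  \<open>(a i, 1)\<close> and \<open>(1, 0)\<close> for \<open>i < P\<close>, each of determinant
  \<open>-1\<close>. Positive partial quotients keep the denominators away from zero.\<close>

lemma cf_convergent_moebius:
  assumes "\<And>i. a i \<ge> 1"
  shows "\<exists>A B C D :: int. A \<ge> 1 \<and> B \<ge> 0 \<and> C \<ge> 0 \<and> D \<ge> 0 \<and> (P \<ge> 1 \<longrightarrow> C \<ge> 1) \<and>
    \<bar>A * D - B * C\<bar> = 1 \<and>
    (\<forall>n. cf_convergent a (n + P) =
       (of_int A * cf_convergent (\<lambda>i. a (i + P)) n + of_int B) /
       (of_int C * cf_convergent (\<lambda>i. a (i + P)) n + of_int D))"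
  using assms
proof (induction P arbitrary: a)
  case 0
  show ?case
    by (intro exI[of _ 1] exI[of _ 0]) simp
next
  case (Suc P)
  obtain A B C D :: int where ABCD: "A \<ge> 1" "B \<ge> 0" "C \<ge> 0" "D \<ge> 0" "\<bar>A * D - B * C\<bar> = 1"
    and eq: "\<And>n. cf_convergent (\<lambda>i. a (Suc i)) (n + P) =
       (of_int A * cf_convergent (\<lambda>i. a (Suc (i + P))) n + of_int B) /
       (of_int C * cf_convergent (\<lambda>i. a (Suc (i + P))) n + of_int D)"
    using Suc.IH[of "\<lambda>i. a (Suc i)", OF Suc.prems] by blast
  have a0: "a 0 \<ge> 1" by (rule Suc.prems)
  show ?case
  proof (intro exI conjI allI impI)
    show "a 0 * A + C \<ge> 1" using a0 ABCD mult_mono[of 1 "a 0" 1 A] by simp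
    show "a 0 * B + D \<ge> 0" using a0 ABCD by simp
    have "(a 0 * A + C) * B - (a 0 * B + D) * A = - (A * D - B * C)" by (simp add: algebra_simps)
    then show "\<bar>(a 0 * A + C) * B - (a 0 * B + D) * A\<bar> = 1" using ABCD(5) by simp
    show "cf_convergent a (n + Suc P) =
       (of_int (a 0 * A + C) * cf_convergent (\<lambda>i. a (i + Suc P)) n + of_int (a 0 * B + D)) /
       (of_int A * cf_convergent (\<lambda>i. a (i + Suc P)) n + of_int B)" for n
    proof -
      define x where "x = cf_convergent (\<lambda>i. a (Suc (i + P))) n"
      have "x \<ge> 1" unfolding x_def by (rule cf_convergent_ge_1) (rule Suc.prems)
      then have "of_int A * x + of_int B > 0"
        using ABCD(1,2) by (intro add_pos_nonneg mult_pos_pos) auto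
      moreover have "cf_convergent a (n + Suc P) = of_int (a 0) + 1 / ((of_int A * x + of_int B) / (of_int C * x + of_int D))"
        using eq[of n] by (simp add: x_def)
      ultimately show ?thesis
        by (simp add: x_def[symmetric] divide_simps) (simp add: algebra_simps)
    qed
  qed (use ABCD in simp_all)
qed

lemma exists_quadratic_unit:
  assumes "0 < \<gamma>" "\<gamma> < 1" "\<gamma> \<notin> \<rat>" "has_purely_periodic_cf (1 / \<gamma>)"
  obtains t d where "quadratic_unit t d" "\<gamma> \<in> quadratic_unit.quadratic_field d"
proof -
  define \<theta> where "\<theta> = 1 / \<gamma>"
  have \<theta>: "\<theta> > 1" using assms by (simp add: \<theta>_def)
  obtain a P where P: "P \<ge> 1" and per: "\<And>i. a (i + P) = a i" and cf: "is_cf_of a \<theta>"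
    using assms(4) by (auto simp: has_purely_periodic_cf_def \<theta>_def)
  \<comment> \<open>The leading quotient is positive too, since it recurs at index
    \<open>P\<close>.\<close>
  have a: "a i \<ge> 1" for i
    using cf P per[of i] by (metis is_cf_of_def trans_le_add2)
  have lim: "cf_convergent a \<longlonglongrightarrow> \<theta>" using cf by (simp add: is_cf_of_def)
  obtain A B C D :: int where ABCD: "A \<ge> 1" "B \<ge> 0" "C \<ge> 1" "D \<ge> 0" "\<bar>A * D - B * C\<bar> = 1"
    and eq: "\<And>n. cf_convergent a (n + P) =
       (of_int A * cf_convergent a n + of_int B) / (of_int C * cf_convergent a n + of_int D)"
    using cf_convergent_moebius[of a P, OF a] P unfolding per by blast
  \<comment> \<open>The eigenvalue of the period matrix for the eigenvector
    \<open>(\<theta>, 1)\<close>: a unit of norm \<open>\<nu>\<close> and trace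
    \<open>\<tau>\<close>.\<close>
  define e0 where "e0 = C * \<theta> + D"
  have "C * \<theta> \<ge> 1 * \<theta>" using ABCD \<theta> by (intro mult_right_mono) auto
  moreover have "real_of_int D \<ge> 0" using ABCD by simp
  ultimately have e0: "e0 > 1" using \<theta> unfolding e0_def by linarith
  have "(\<lambda>n. cf_convergent a (n + P)) \<longlonglongrightarrow> (A * \<theta> + B) / (C * \<theta> + D)"
    unfolding eq using e0 by (intro tendsto_intros lim) (simp add: e0_def)
  then have "\<theta> = (A * \<theta> + B) / (C * \<theta> + D)"
    using LIMSEQ_ignore_initial_segment[OF lim] LIMSEQ_unique by blast
  then have fixpoint: "\<theta> * (C * \<theta> + D) = A * \<theta> + B" using e0 by (simp add: e0_def field_simps)
  define \<tau> where "\<tau> = A + D"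
  define \<nu> where "\<nu> = A * D - B * C"
  have "\<nu> = 1 \<or> \<nu> = - 1" using ABCD(5) unfolding \<nu>_def by linarith
  then have \<nu>2: "\<nu> * \<nu> = 1" by auto
  have "e0 * e0 = C * (\<theta> * (C * \<theta> + D)) + D * e0" by (simp add: e0_def algebra_simps)
  also have "\<dots> = \<tau> * e0 - \<nu>" unfolding fixpoint by (simp add: e0_def \<tau>_def \<nu>_def algebra_simps)
  finally have e0_eq: "e0 * e0 = \<tau> * e0 - \<nu>" .
  \<comment> \<open>The trace of the squared period matrix. Squaring makes the norm \<open>1\<close>
    also when \<open>\<nu> = - 1\<close>.\<close>
  define t where "t = \<tau> * \<tau> - 2 * \<nu>"
  define d where "d = 1 / (e0 * e0)"
  have e_gt: "e0 * e0 > 1" using mult_strict_mono[of 1 e0 1 e0] e0 by simp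
  have "e0 * e0 + \<nu> = \<tau> * e0" using e0_eq by simp
  then have "(e0 * e0 + \<nu>) * (e0 * e0 + \<nu>) = \<tau> * \<tau> * (e0 * e0)"
    by simp
  then have e_eq: "(e0 * e0) * (e0 * e0) + 1 = t * (e0 * e0)"
    using \<nu>2 by (simp add: t_def algebra_simps flip: of_int_mult)
  have d: "0 < d" "d < 1" using e_gt by (simp_all add: d_def)
  have d_eq: "d * d + 1 = t * d"
    using e_eq e0 by (simp add: d_def divide_simps)
  have \<tau>: "\<tau> \<ge> 1" using ABCD by (simp add: \<tau>_def)
  \<comment> \<open>Squaring does not shrink the field: \<open>\<tau> * e0 = e0 * e0 + \<nu>\<close>
    recovers \<open>e0\<close>, and with it \<open>\<gamma>\<close>, rationally from
    \<open>d\<close>. This also makes \<open>d\<close> irrational.\<close>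
  have e0_d: "e0 = (1 / d + \<nu>) / \<tau>" using e0_eq \<tau> by (simp add: d_def field_simps)
  have \<theta>_d: "\<theta> = ((1 / d + \<nu>) / \<tau> - D) / C" using ABCD(3) by (simp add: e0_d[symmetric] e0_def)
  have \<gamma>_d: "\<gamma> = inverse (((inverse d + \<nu>) * inverse \<tau> + (- D)) * inverse C)"
  proof -
    have "\<gamma> = inverse \<theta>" by (simp add: \<theta>_def)
    also have "\<theta> = ((inverse d + \<nu>) * inverse \<tau> + (- D)) * inverse C"
      using \<theta>_d by (simp add: divide_inverse)
    finally show ?thesis .
  qed
  have "d \<notin> \<rat>"
  proof
    assume "d \<in> \<rat>"
    then have "\<gamma> \<in> \<rat>" unfolding \<gamma>_d by simp
    then show False using assms(3) by simp
  qed
  then interpret quadratic_unit t d using d d_eq by unfold_locales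
  have inv: "inverse u \<in> quadratic_field" if "u \<in> quadratic_field" for u
    using quadratic_field_inverse[OF that] quadratic_field_rat[of 0] by (cases "u = 0") auto
  have "\<gamma> \<in> quadratic_field"
    unfolding \<gamma>_d
    by (intro inv quadratic_field_mult quadratic_field_add quadratic_field_d quadratic_field_rat) simp_all
  then show thesis using that quadratic_unit_axioms by blast
qed

theorem corollary11:
  fixes \<gamma> \<alpha> \<beta> :: real
  assumes "0 < \<gamma>" and "\<gamma> < 1"
    and "quadratic_irrational \<gamma>"
    and "has_purely_periodic_cf (1 / \<gamma>)"
    and "\<alpha> \<in> rat_adjoin \<gamma>" and "\<beta> \<in> rat_adjoin \<gamma>"
  shows "decidable (fm_code ` true_sentences {(n, y). int y = \<lfloor>real n * \<alpha> + \<beta>\<rfloor>})"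
proof -
  obtain t d where "quadratic_unit t d" and \<gamma>: "\<gamma> \<in> quadratic_unit.quadratic_field d"
    using exists_quadratic_unit assms(1-4) by (metis quadratic_irrational_def)
  then interpret quadratic_unit t d by simp
  show ?thesis
    using rat_adjoin_subset[OF \<gamma>] assms(5,6) by (intro decidable_floor) auto
qed

end
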